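(* For every integer $d\ge 2$ and every $r\in\mathbb{C}$, the vertex operator algebra $V_{\mathcal{J}}$ (of central charge $dr$) is simple if and only if $r\notin\mathbb{Z}$.
   Context: Fix an integer $d\ge 2$ and $r\in\mathbb{C}$. Let $\hat{\mathfrak h}$ be the complex Lie algebra with basis $\{v^i(m)\mid 1\le i\le d,\ m\in\mathbb{Z}\}\cup\{\mathbf c\}$ and bracket $[v^i(m),v^j(n)]=\delta_{m+n,0}\delta_{i,j}\,m\,\mathbf c$, $[\mathbf c,\hat{\mathfrak h}]=0$. In $A=U(\hat{\mathfrak h})/\langle \mathbf c-1\rangle$ let $v^{ij}(m,n)$ be the image of $v^i(m)v^j(n)$; then $v^{ij}(m,n)=v^{ji}(n,m)$ unless $i=j$ and $m=-n$, and $v^{ii}(m,-m)=v^{ii}(-m,m)+m$. Let $\mathcal B=\{v^{ii}(m,n)\mid 1\le i\le d,\ m\le n\}\cup\{v^{ij}(m,n)\mid 1\le i<j\le d,\ m,n\in\mathbb Z\}$; then $\mathcal B\cup\{1\}$ is linearly independent, $\mathcal L:=\mathrm{span}_{\mathbb C}\mathcal B\oplus\mathbb C\subset A$ contains every $v^{ij}(m,n)$ and is closed under $[x,y]=xy-yx$. With $\pi_1,\pi_2$ the projections of $\mathcal L$ onto $\mathrm{span}\,\mathcal B$ and onto $\mathbb C$, the formula $[x,y]_r=\pi_1([x,y])+r\pi_2([x,y])$ defines a Lie bracket on $\mathcal L$; call this Lie algebra $\mathcal L_r$. Let $\mathcal B_+=\{v^{ij}(m,n)\in\mathcal B\mid m\ge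 0\text{ or }n\ge 0\}$, $\mathcal B_-=\{v^{ij}(m,n)\in\mathcal B\mid m,n<0\}$, $\mathcal L_r^+=\mathrm{span}\,\mathcal B_+\oplus\mathbb C$ (a subalgebra), and $M_r=U(\mathcal L_r)\otimes_{U(\mathcal L_r^+)}\mathbb C\mathbf 1$, where $\mathcal B_+$ acts by $0$ on $\mathbf 1$ and $s\in\mathbb C\subset \mathcal L_r$ acts by the scalar $s$. Elements of $\mathcal B_-$ commute, monomials in $\mathcal B_-$ applied to $\mathbf 1$ form a basis of $M_r$, and $M_r=\bigoplus_{n\ge0}(M_r)_n$ is graded by giving $x_p\cdots x_1\mathbf 1$ with $x_q=v^{i_qj_q}(m_q,n_q)\in\mathcal B_-$ degree $-\sum_q(m_q+n_q)$. Define operators on $M_r$: $L_r^{ij}(m)=\frac12\sum_{h\in\mathbb Z}v^{ij}(m-h,h)$ if $i\ne j$ or $m\ne0$, and $L_r^{ii}(0)=\frac12 v^{ii}(0,0)+\sum_{h>0}v^{ii}(-h,h)$. Let $\omega_r^{ij}=L_r^{ij}(-2)\mathbf 1$, $\omega=\sum_i\omega_r^{ii}$, and let $V_{\mathcal J}\subset M_r$ be the span of all $L_r^{i_1j_1}(m_1)\cdots L_r^{i_pj_p}(m_p)\mathbf 1$ ($p\ge0$), graded by $(V_{\mathcal J})_n=V_{\mathcal J}\cap (M_r)_n$. By a theorem of Ashihara–Miyamoto, there is a unique linear map $Y(\cdot,z):V_{\mathcal J}\to\mathrm{End}(V_{\mathcal J})[[z,z^{-1}]]$ with $Y(\omega_r^{ij},z)=\sum_m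 L_r^{ij}(m)z^{-m-2}$ and $Y(\mathbf 1,z)=\mathrm{Id}$ making $(V_{\mathcal J},Y,\mathbf 1,\omega)$ a vertex operator algebra of central charge $dr$ (its Griess algebra is isomorphic to the Jordan algebra of $d\times d$ symmetric matrices). Simple means having no ideals other than $0$ and itself. *)

theory Defs
  imports Complex_Main "HOL-Library.Multiset" "HOL-Library.Function_Algebras"
          "HOL-Library.Groups_Big_Fun"
begin

text \<open>An index (i,j,m,n) stands for the element v^{ij}(m,n) of A (the image of
  v^i(m) v^j(n)).  The basis B consists of normalized indices: (i,i,m,n) with m \<le> n,
  and (i,j,m,n) with i < j.  Elements of L = span B \<oplus> C are represented as coefficient
  functions on idx option: Some b is the coefficient of the basis element b, None
  is the coefficient of the constant 1.\<close>

type_synonym idx = "nat \<times> nat \<times> int \<times> int"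
type_synonym lel = "idx option \<Rightarrow> complex"
type_synonym vec = "idx multiset \<Rightarrow> complex"

definition bas :: "idx \<Rightarrow> lel" where
  "bas b = (\<lambda>x. if x = Some b then 1 else 0)"

definition lone :: lel where
  "lone = (\<lambda>x. if x = None then 1 else 0)"

text \<open>The element v^{ij}(m,n) of A, expressed in the basis B \<union> {1} of L.\<close>
definition vnorm :: "nat \<Rightarrow> nat \<Rightarrow> int \<Rightarrow> int \<Rightarrow> lel" where
  "vnorm i j m n =
    (if i < j then bas (i,j,m,n)
     else if j < i then bas (j,i,n,m)
     else if m \<le> n then bas (i,i,m,n)
     else if m = - n then (\<lambda>x. bas (i,i,n,m) x + of_int m * lone x)
     else bas (i,i,n,m))"

text \<open>The commutator [x,y] = xy - yx in A of v^{ij}(a,b) and v^{kl}(c,e).\<close>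
definition brA :: "idx \<Rightarrow> idx \<Rightarrow> lel" where
  "brA p q = (case p of (i,j,a,b) \<Rightarrow> case q of (k,l,c,e) \<Rightarrow> (\<lambda>x.
       (if j = k \<and> b + c = 0 then of_int b * vnorm i l a e x else 0)
     + (if j = l \<and> b + e = 0 then of_int b * vnorm i k a c x else 0)
     + (if i = k \<and> a + c = 0 then of_int a * vnorm l j e b x else 0)
     + (if i = l \<and> a + e = 0 then of_int a * vnorm k j c b x else 0)))"

definition brR :: "complex \<Rightarrow> idx \<Rightarrow> idx \<Rightarrow> lel" where
  "brR r p q = (\<lambda>x. if x = None then r * brA p q x else brA p q x)"

definition isBm :: "idx \<Rightarrow> bool" where
  "isBm b = (case b of (i,j,m,n) \<Rightarrow> m < 0 \<and> n < 0)"

text \<open>By the PBW-type statement in the context, M_r has basis the monomials in B_-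
  applied to 1; we identify M_r with finitely supported functions on multisets of
  B_- indices.  The action of a basis element x on a monomial y_1 ... y_p 1 is
  computed by x y_1 y_2...y_p 1 = [x,y_1]_r y_2...y_p 1 + y_1 (x y_2 ... y_p 1),
  with B_+ killing 1, B_- acting by multiplication and constants by scalars.\<close>

definition mono :: "idx multiset \<Rightarrow> vec" where
  "mono M = (\<lambda>\<mu>. if \<mu> = M then 1 else 0)"

definition mulB :: "idx \<Rightarrow> vec \<Rightarrow> vec" where
  "mulB y v = (\<lambda>\<mu>. if y \<in># \<mu> then v (\<mu> - {#y#}) else 0)"

primrec Fr :: "complex \<Rightarrow> idx list \<Rightarrow> idx \<Rightarrow> vec" where
  "Fr r [] b = (if isBm b then mono {#b#} else 0)"
| "Fr r (y # zs) b =
     (if isBm b then mono (add_mset b (mset (y # zs)))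
      else (\<lambda>\<mu>. (\<Sum>c\<in>{c. brR r b y (Some c) \<noteq> 0}. brR r b y (Some c) * Fr r zs c \<mu>)
               + brR r b y None * mono (mset zs) \<mu>
               + mulB y (Fr r zs b) \<mu>))"

definition act_basis :: "complex \<Rightarrow> idx \<Rightarrow> vec \<Rightarrow> vec" where
  "act_basis r b v = (\<lambda>\<nu>. \<Sum>\<mu>\<in>{\<mu>. v \<mu> \<noteq> 0}. v \<mu> * Fr r (SOME xs. mset xs = \<mu>) b \<nu>)"

definition act :: "complex \<Rightarrow> lel \<Rightarrow> vec \<Rightarrow> vec" where
  "act r x v = (\<lambda>\<nu>. (\<Sum>c\<in>{c. x (Some c) \<noteq> 0}. x (Some c) * act_basis r c v \<nu>) + x None * v \<nu>)"

definition mdeg :: "idx multiset \<Rightarrow> int" where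
  "mdeg \<mu> = sum_mset (image_mset (\<lambda>(i,j,m,n). - (m + n)) \<mu>)"

definition smult :: "complex \<Rightarrow> vec \<Rightarrow> vec" where
  "smult a v = (\<lambda>\<mu>. a * v \<mu>)"

definition Lop :: "complex \<Rightarrow> nat \<Rightarrow> nat \<Rightarrow> int \<Rightarrow> vec \<Rightarrow> vec" where
  "Lop r i j m v =
    (if i = j \<and> m = 0 then
       (\<lambda>\<nu>. (1/2) * act_basis r (i,i,0,0) v \<nu>
            + Sum_any (\<lambda>h::int. if h > 0 then act_basis r (i,i,-h,h) v \<nu> else 0))
     else (\<lambda>\<nu>. (1/2) * Sum_any (\<lambda>h::int. act r (vnorm i j (m - h) h) v \<nu>)))"

definition vac :: vec where "vac = mono {#}"

definition omega_ij :: "complex \<Rightarrow> nat \<Rightarrow> nat \<Rightarrow> vec" where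
  "omega_ij r i j = Lop r i j (-2) vac"

definition omega :: "nat \<Rightarrow> complex \<Rightarrow> vec" where
  "omega d r = (\<Sum>i\<in>{1..d}. omega_ij r i i)"

inductive_set lspan :: "vec set \<Rightarrow> vec set" for G where
  lspan_zero: "0 \<in> lspan G"
| lspan_gen: "g \<in> G \<Longrightarrow> g \<in> lspan G"
| lspan_add: "u \<in> lspan G \<Longrightarrow> w \<in> lspan G \<Longrightarrow> u + w \<in> lspan G"
| lspan_smult: "u \<in> lspan G \<Longrightarrow> smult a u \<in> lspan G"

definition VJ :: "nat \<Rightarrow> complex \<Rightarrow> vec set" where
  "VJ d r = lspan {foldr (\<lambda>(i,j,m) w. Lop r i j m w) ops vac | ops.
                   \<forall>(i,j,m)\<in>set ops. i \<in> {1..d} \<and> j \<in> {1..d}}"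

section \<open>Vertex operator algebras (modes: Y(u,z) = \<Sum>_n u_n z^{-n-1}, u_n = Y u n)\<close>

definition subspace :: "vec set \<Rightarrow> bool" where
  "subspace S \<longleftrightarrow> 0 \<in> S \<and> (\<forall>u\<in>S. \<forall>w\<in>S. u + w \<in> S) \<and> (\<forall>a. \<forall>u\<in>S. smult a u \<in> S)"

definition fdim :: "vec set \<Rightarrow> bool" where
  "fdim S \<longleftrightarrow> (\<exists>G. finite G \<and> S \<subseteq> lspan G)"

definition comp :: "int \<Rightarrow> vec \<Rightarrow> vec" where
  "comp n v = (\<lambda>\<mu>. if mdeg \<mu> = n then v \<mu> else 0)"

definition Vn :: "vec set \<Rightarrow> int \<Rightarrow> vec set" where
  "Vn V n = {v \<in> V. \<forall>\<mu>. v \<mu> \<noteq> 0 \<longrightarrow> mdeg \<mu> = n}"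

definition is_VOA :: "vec set \<Rightarrow> (vec \<Rightarrow> int \<Rightarrow> vec \<Rightarrow> vec) \<Rightarrow> vec \<Rightarrow> vec \<Rightarrow> complex \<Rightarrow> bool" where
  "is_VOA V Y one om c \<longleftrightarrow>
     subspace V
   \<and> (\<forall>v\<in>V. \<forall>n. comp n v \<in> V)
   \<and> (\<forall>n. fdim (Vn V n))
   \<and> (\<exists>N. \<forall>n<N. Vn V n = {0})
   \<and> (\<forall>u\<in>V. \<forall>n. \<forall>w\<in>V. Y u n w \<in> V)
   \<and> (\<forall>u\<in>V. \<forall>u'\<in>V. \<forall>w\<in>V. \<forall>a b n.
        Y (smult a u + smult b u') n w = smult a (Y u n w) + smult b (Y u' n w))
   \<and> (\<forall>u\<in>V. \<forall>w\<in>V. \<forall>w'\<in>V. \<forall>a b n.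
        Y u n (smult a w + smult b w') = smult a (Y u n w) + smult b (Y u n w'))
   \<and> (\<forall>u\<in>V. \<forall>w\<in>V. \<exists>N. \<forall>n\<ge>N. Y u n w = 0)
   \<and> one \<in> V
   \<and> (\<forall>w\<in>V. \<forall>n. Y one n w = (if n = -1 then w else 0))
   \<and> (\<forall>u\<in>V. Y u (-1) one = u \<and> (\<forall>n\<ge>0. Y u n one = 0))
   \<and> (\<forall>u\<in>V. \<forall>v\<in>V. \<forall>w\<in>V. \<forall>p q s.
        Sum_any (\<lambda>i::nat. smult (of_int p gchoose i) (Y (Y u (s + int i) v) (p + q - int i) w))
      = Sum_any (\<lambda>i::nat. smult ((-1) ^ i * (of_int s gchoose i))
           (Y u (p + s - int i) (Y v (q + int i) w)
            - smult ((-1) powi s) (Y v (q + s - int i) (Y u (p + int i) w)))))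
   \<and> om \<in> V
   \<and> (\<forall>m n. \<forall>w\<in>V.
        Y om (m + 1) (Y om (n + 1) w) - Y om (n + 1) (Y om (m + 1) w)
      = smult (of_int (m - n)) (Y om (m + n + 1) w)
        + smult ((of_int m ^ 3 - of_int m) / 12 * (if m + n = 0 then 1 else 0) * c) w)
   \<and> (\<forall>n. \<forall>v\<in>Vn V n. Y om 1 v = smult (of_int n) v)
   \<and> (\<forall>u\<in>V. \<forall>n. \<forall>w\<in>V. Y (Y om 0 u) n w = smult (- of_int n) (Y u (n - 1) w))"

definition is_ideal :: "vec set \<Rightarrow> (vec \<Rightarrow> int \<Rightarrow> vec \<Rightarrow> vec) \<Rightarrow> vec set \<Rightarrow> bool" where
  "is_ideal V Y I \<longleftrightarrow> subspace I \<and> I \<subseteq> V \<and>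
     (\<forall>u\<in>V. \<forall>w\<in>I. \<forall>n. Y u n w \<in> I \<and> Y w n u \<in> I)"

definition simple_VOA :: "vec set \<Rightarrow> (vec \<Rightarrow> int \<Rightarrow> vec \<Rightarrow> vec) \<Rightarrow> bool" where
  "simple_VOA V Y \<longleftrightarrow> (\<forall>I. is_ideal V Y I \<longrightarrow> I = {0} \<or> I = V)"

text \<open>Y is a vertex operator map on V_J as in the Ashihara--Miyamoto theorem.\<close>
definition VJ_vertex_operator :: "nat \<Rightarrow> complex \<Rightarrow> (vec \<Rightarrow> int \<Rightarrow> vec \<Rightarrow> vec) \<Rightarrow> bool" where
  "VJ_vertex_operator d r Y \<longleftrightarrow>
     is_VOA (VJ d r) Y vac (omega d r) (of_nat d * r)
   \<and> (\<forall>i\<in>{1..d}. \<forall>j\<in>{1..d}. \<forall>n. \<forall>w\<in>VJ d r. Y (omega_ij r i j) n w = Lop r i j (n - 1) w)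
   \<and> (\<forall>n. \<forall>w\<in>VJ d r. Y vac n w = (if n = -1 then w else 0))"

end

theory Submission
  imports Defs "HOL-Library.Poly_Mapping"
begin

text \<open>M_r is a polynomial algebra in symmetric variables X a b indexed by pairs of letters
  a = v^i(m), m < 0, on which the Lie algebra acts by the multiplications X a b, the derivations
  E a b (replacing the letter b by a) and second order operators D a b.  The zero modes
  L^{jj}(0) are diagonal, so a subspace stable under all L^{ij}(m) is stable under every single
  v^{ij}(m,n) with i and j distinct and, as d \<ge> 2, under all X, E and D.  Hence V_J is the full
  polynomial algebra in the letters of colours 1,...,d, and by Borcherds' identity its ideals are
  exactly the subspaces stable under X, E and D.

  If r is not an integer, the common kernel of the D a b consists of the constants: on
  polynomials in a finite set S of letters, the sum of X N a D a N over a in S equals the sum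
  of E N a E a N plus (r - 1 - |S|) E N N, so a vector of minimal positive degree \<mu> in N killed
  by all D would satisfy \<mu> (\<mu> + r - 1 - |S|) = 0.  Thus every nonzero ideal contains 1.

  If r is an integer, there is a nonconstant vector killed by all D: the symmetric determinant
  of size r + 1 if r \<ge> 0, and a power of a determinant of size 1 or 2 if r < 0, according to the
  parity of r.  Hence the vectors on which all words in the D have constant term 0 form a
  proper nonzero ideal.\<close>

section \<open>Operators on polynomial algebras\<close>

text \<open>The relations of \<open>X\<close>, \<open>E\<close> and \<open>D\<close> are those of
  oscillators with r components. For a positive integer r one may read \<open>X a b\<close> as the
  sum over k of x_a^k x_b^k, \<open>E a b\<close> as the sum of x_a^k d/dx_b^k, and
  \<open>D r a b\<close> as the sum of d/dx_a^k d/dx_b^k, with k an upper index from 1 to r. This is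
  only a guide, but it predicts the singular vectors: a Gram matrix of r + 1 vectors in r-space has
  determinant zero, while for r = -2j (anticommuting components) and r = 1 - 2j (one more commuting
  component) determinants of size 1 and 2 become nilpotent. For general complex r no such
  realization is at hand, so the operators are prescribed through their commutators with the
  variables, and their existence has to be proved: the condition is a Jacobi identity. The factor
  1/2 in \<open>sdet\<close> compensates that \<open>E (c n) (c k)\<close>, applied to a symmetric
  determinant, replaces first row k and then column k, with equal results.\<close>

type_synonym 'v mpol = "'v multiset \<Rightarrow>\<^sub>0 complex"
type_synonym pol = "idx mpol"

abbreviation lookup :: "('a \<Rightarrow>\<^sub>0 'b::zero) \<Rightarrow> 'a \<Rightarrow> 'b" where
  "lookup \<equiv> Poly_Mapping.lookup"

abbreviation keys :: "('a \<Rightarrow>\<^sub>0 'b::zero) \<Rightarrow> 'a set" where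
  "keys \<equiv> Poly_Mapping.keys"

abbreviation cst :: "complex \<Rightarrow> 'v mpol" where
  "cst c \<equiv> Poly_Mapping.single 0 c"

abbreviation mon :: "'v multiset \<Rightarrow> 'v mpol" where
  "mon \<mu> \<equiv> Poly_Mapping.single \<mu> 1"

definition var :: "'v \<Rightarrow> 'v mpol" where
  "var y = mon {#y#}"

lemma mon_add_mset: "mon (add_mset y \<mu>) = var y * mon \<mu>"
  by (simp add: var_def mult_single)

lemma lookup_var_times:
  fixes p :: "'v mpol"
  shows "lookup (var y * p) \<mu> = (if y \<in># \<mu> then lookup p (\<mu> - {#y#}) else 0)"
proof -
  have "lookup (var y * p) \<mu> = Sum_any (\<lambda>q. lookup p q when \<mu> = {#y#} + q)"
    by (simp add: var_def lookup_mult lookup_single when_mult)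
  also have "\<dots> = (if y \<in># \<mu> then lookup p (\<mu> - {#y#}) else 0)"
  proof (cases "y \<in># \<mu>")
    case True
    then have "(\<lambda>q. lookup p q when \<mu> = {#y#} + q) = (\<lambda>q. lookup p q when \<mu> - {#y#} = q)"
      by (auto simp: fun_eq_iff when_def)
    with True show ?thesis by (simp only: Sum_any_when_equal' if_True)
  next
    case False
    then have "(\<lambda>q. lookup p q when \<mu> = {#y#} + q) = (\<lambda>q. 0)"
      by (auto simp: fun_eq_iff when_def)
    then have "Sum_any (\<lambda>q. lookup p q when \<mu> = {#y#} + q) = Sum_any (\<lambda>q :: 'v multiset. 0 :: complex)"
      by (rule arg_cong)
    with False show ?thesis by simp
  qed
  finally show ?thesis .
qed

lemma lookup_cst_times [simp]:
  fixes p :: "'v mpol"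
  shows "lookup (cst c * p) \<mu> = c * lookup p \<mu>"
  by (simp add: lookup_mult lookup_single when_mult)

lemma lookup_numeral_times [simp]:
  fixes p :: "'v mpol"
  shows "lookup (numeral n * p) \<mu> = numeral n * lookup p \<mu>"
  using lookup_cst_times[of "numeral n" p \<mu>] by (simp only: single_numeral)

lemma lookup_of_nat_times [simp]:
  fixes p :: "'v mpol"
  shows "lookup (of_nat n * p) \<mu> = of_nat n * lookup p \<mu>"
  using lookup_cst_times[of "of_nat n" p \<mu>] by (simp only: single_of_nat)

lemma cst_times_eq_0_iff [simp]:
  fixes p :: "'v mpol"
  shows "cst c * p = 0 \<longleftrightarrow> c = 0 \<or> p = 0"
  by (auto simp: poly_mapping_eq_iff fun_eq_iff)

lemma numeral_times_eq_0_iff [simp]: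
  fixes p :: "'v mpol"
  shows "numeral n * p = 0 \<longleftrightarrow> p = 0"
  by (auto simp: poly_mapping_eq_iff fun_eq_iff)

lemma cst_mult: "cst (a * b) = cst a * cst b"
  by (simp add: mult_single)

lemma pol_eq_sum:
  fixes p :: "'v mpol"
  shows "p = (\<Sum>\<mu>\<in>keys p. cst (lookup p \<mu>) * mon \<mu>)"
proof (rule poly_mapping_eqI)
  fix \<nu>
  have "lookup (\<Sum>\<mu>\<in>keys p. cst (lookup p \<mu>) * mon \<mu>) \<nu>
      = (\<Sum>\<mu>\<in>keys p. lookup p \<mu> * lookup (mon \<mu>) \<nu>)"
    by (simp only: lookup_sum lookup_cst_times)
  also have "\<dots> = (\<Sum>\<mu>\<in>keys p. if \<nu> = \<mu> then lookup p \<mu> else 0)"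
    by (intro sum.cong) (auto simp: lookup_single)
  also have "\<dots> = lookup p \<nu>"
    by (simp add: in_keys_iff)
  finally show "lookup p \<nu> = lookup (\<Sum>\<mu>\<in>keys p. cst (lookup p \<mu>) * mon \<mu>) \<nu>" by simp
qed

definition lin :: "('v mpol \<Rightarrow> 'w mpol) \<Rightarrow> bool" where
  "lin T \<longleftrightarrow> (\<forall>p q. T (p + q) = T p + T q) \<and> (\<forall>c p. T (cst c * p) = cst c * T p)"

lemma linI: "(\<And>p q. T (p + q) = T p + T q) \<Longrightarrow> (\<And>c p. T (cst c * p) = cst c * T p) \<Longrightarrow> lin T"
  by (simp add: lin_def)

lemma lin_add: "lin T \<Longrightarrow> T (p + q) = T p + T q"
  and lin_cst: "lin T \<Longrightarrow> T (cst c * p) = cst c * T p"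
  by (simp_all add: lin_def)

lemma lin_zero: "lin T \<Longrightarrow> T 0 = 0"
  using lin_cst[of T 0 0] by simp

lemma lin_minus: "lin T \<Longrightarrow> T (- p) = - T p"
  using lin_cst[of T "-1" p] by (simp add: single_uminus)

lemma lin_diff: "lin T \<Longrightarrow> T (p - q) = T p - T q"
  using lin_add[of T p "- q"] by (simp add: lin_minus)

lemma lin_sum: "lin T \<Longrightarrow> T (\<Sum>x\<in>A. f x) = (\<Sum>x\<in>A. T (f x))"
  by (induction A rule: infinite_finite_induct) (simp_all add: lin_zero lin_add)

lemma lin_numeral: "lin T \<Longrightarrow> T (numeral n * p) = numeral n * T p"
  using lin_cst[of T "numeral n" p] by simp

lemma lin_of_bool: "lin T \<Longrightarrow> T (of_bool b * p) = of_bool b * T p"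
  by (cases b) (simp_all add: lin_zero)

lemma lin_plus: "lin S \<Longrightarrow> lin T \<Longrightarrow> lin (\<lambda>p. S p + T p)"
  by (simp add: lin_def algebra_simps)

lemma lin_times: "lin T \<Longrightarrow> lin (\<lambda>p. g * T p)"
  by (simp add: lin_def algebra_simps)

lemma lin_mult: "lin (\<lambda>p. g * p)"
  by (simp add: lin_def algebra_simps)

lemma lin_compose: "lin S \<Longrightarrow> lin T \<Longrightarrow> lin (\<lambda>p. S (T p))"
  by (simp add: lin_def)

lemma lin_eq_monI:
  assumes "lin S" "lin T" "\<And>\<mu>. S (mon \<mu>) = T (mon \<mu>)"
  shows "S p = T p"
proof -
  have "S (\<Sum>\<mu>\<in>keys p. cst (lookup p \<mu>) * mon \<mu>) = T (\<Sum>\<mu>\<in>keys p. cst (lookup p \<mu>) * mon \<mu>)"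
    by (simp only: lin_sum[OF assms(1)] lin_sum[OF assms(2)] lin_cst[OF assms(1)]
        lin_cst[OF assms(2)] assms(3))
  then show ?thesis by (simp only: pol_eq_sum[symmetric])
qed

lemma pol_induct [case_names one var add cst]:
  assumes one: "Q (1 :: 'v mpol)"
    and var: "\<And>y p. Q p \<Longrightarrow> Q (var y * p)"
    and add: "\<And>p q. Q p \<Longrightarrow> Q q \<Longrightarrow> Q (p + q)"
    and cst: "\<And>c p. Q p \<Longrightarrow> Q (cst c * p)"
  shows "Q p"
proof -
  have mon: "Q (mon \<mu>)" for \<mu> :: "'v multiset"
  proof (induction \<mu>)
    case empty
    show ?case using one by (simp flip: single_one)
  next
    case (add y \<mu>)
    then show ?case by (simp only: mon_add_mset var)
  qed
  have zero: "Q 0" using cst[OF one, of 0] by simp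
  have "Q (\<Sum>\<mu>\<in>A. cst (lookup p \<mu>) * mon \<mu>)" if "finite A" for A
    using that by (induction A) (auto intro: zero add cst mon)
  then show ?thesis by (subst pol_eq_sum) simp
qed

lemma lin_eqI:
  assumes S: "lin S" and T: "lin T" and one: "S 1 = T 1"
    and var: "\<And>y p. S p = T p \<Longrightarrow> S (var y * p) = T (var y * p)"
  shows "S p = T p"
  by (induction p rule: pol_induct)
    (use one var in \<open>simp_all add: lin_add[OF S] lin_add[OF T] lin_cst[OF S] lin_cst[OF T]\<close>)

text \<open>The operator killing 1 whose commutator with multiplication by the variable y is
  G y; it exists as soon as the commutator of G y with z is symmetric in y and z.\<close>

definition mon_op :: "('v \<Rightarrow> 'v mpol \<Rightarrow> 'v mpol) \<Rightarrow> 'v multiset \<Rightarrow> 'v mpol" where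
  "mon_op G \<mu> = snd (fold_mset (\<lambda>y a. (var y * fst a, G y (fst a) + var y * snd a)) (1, 0) \<mu>)"

definition comm_op :: "('v \<Rightarrow> 'v mpol \<Rightarrow> 'v mpol) \<Rightarrow> 'v mpol \<Rightarrow> 'v mpol" where
  "comm_op G p = (\<Sum>\<mu>\<in>keys p. cst (lookup p \<mu>) * mon_op G \<mu>)"

lemma comm_op_eq_sum:
  "finite A \<Longrightarrow> keys p \<subseteq> A \<Longrightarrow> comm_op G p = (\<Sum>\<mu>\<in>A. cst (lookup p \<mu>) * mon_op G \<mu>)"
  unfolding comm_op_def by (intro sum.mono_neutral_left) (auto simp: in_keys_iff)

lemma lin_comm_op: "lin (comm_op G)"
proof (rule linI)
  fix p q :: "'a mpol"
  have "keys (p + q) \<subseteq> keys p \<union> keys q" by (rule keys_add)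
  then show "comm_op G (p + q) = comm_op G p + comm_op G q"
    using comm_op_eq_sum[of "keys p \<union> keys q" "p + q" G] comm_op_eq_sum[of "keys p \<union> keys q" p G]
      comm_op_eq_sum[of "keys p \<union> keys q" q G]
    by (simp add: lookup_add single_add algebra_simps sum.distrib)
next
  fix c and p :: "'a mpol"
  have "keys (cst c * p) \<subseteq> keys p" by (auto simp: in_keys_iff)
  then show "comm_op G (cst c * p) = cst c * comm_op G p"
    using comm_op_eq_sum[of "keys p" "cst c * p" G]
    by (simp add: comm_op_def sum_distrib_left mult_single flip: mult.assoc)
qed

lemma comm_op_one: "comm_op G 1 = 0"
  using comm_op_eq_sum[of "{0}" 1 G] by (simp add: mon_op_def lookup_one)

lemma comm_op_var:
  assumes lin: "\<And>y. lin (G y)"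
    and sym: "\<And>y z p. G y (var z * p) + var y * G z p = G z (var y * p) + var z * G y p"
  shows "comm_op G (var y * p) = G y p + var y * comm_op G p"
proof -
  let ?f = "\<lambda>y a. (var y * fst a, G y (fst a) + var y * snd a)"
  \<comment> \<open>The fold carries the monomial built so far together with the value of the
    operator on it. Two steps commute exactly because of \<open>sym\<close>, so the order of the
    factors is irrelevant.\<close>
  interpret comp_fun_commute ?f
    using sym by unfold_locales (auto simp: fun_eq_iff algebra_simps)
  have fst: "fst (fold_mset ?f (1, 0) \<mu>) = mon \<mu>" for \<mu>
  proof (induction \<mu>)
    case (add y \<mu>)
    then show ?case by (simp add: mon_add_mset)
  qed (simp flip: single_one)
  have op: "comm_op G (mon \<mu>) = mon_op G \<mu>" for \<mu>
    using comm_op_eq_sum[of "{\<mu>}" "mon \<mu>" G] by (simp add: keys_single)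
  have step: "comm_op G (var y * mon \<mu>) = G y (mon \<mu>) + var y * comm_op G (mon \<mu>)" for \<mu>
  proof -
    have "comm_op G (var y * mon \<mu>) = mon_op G (add_mset y \<mu>)"
      by (simp only: mon_add_mset[symmetric] op)
    also have "\<dots> = G y (mon \<mu>) + var y * mon_op G \<mu>"
      by (simp add: mon_op_def fst)
    finally show ?thesis by (simp only: op)
  qed
  show ?thesis
  proof (rule lin_eq_monI[where p = p])
    show "lin (\<lambda>p. comm_op G (var y * p))"
      by (rule lin_compose[OF lin_comm_op lin_mult])
    show "lin (\<lambda>p. G y p + var y * comm_op G p)"
      by (intro lin_plus lin lin_times lin_comm_op)
  qed (rule step)
qed

definition der :: "('v \<Rightarrow> 'v mpol) \<Rightarrow> 'v mpol \<Rightarrow> 'v mpol" where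
  "der g = comm_op (\<lambda>y p. g y * p)"

lemma lin_der: "lin (der g)"
  by (simp add: der_def lin_comm_op)

lemma der_one: "der g 1 = 0"
  by (simp add: der_def comm_op_one)

lemma der_var: "der g (var y * p) = g y * p + var y * der g p"
  unfolding der_def by (rule comm_op_var) (simp_all add: lin_mult algebra_simps)

lemma der_mult: "der g (p * q) = der g p * q + p * der g q"
proof (induction p rule: pol_induct)
  case (var y p)
  then show ?case by (simp add: der_var mult.assoc) (simp add: algebra_simps)
next
  case (cst c p)
  then show ?case by (simp add: lin_cst[OF lin_der] mult.assoc) (simp add: algebra_simps)
qed (simp_all add: der_one lin_add[OF lin_der] algebra_simps)

section \<open>The polynomial model of \<open>M\<^sub>r\<close>\<close>

text \<open>The letter (i,m) with m < 0 stands for the creation operator v^i(m).  In terms of letters,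
  v^{ij}(m,n) multiplies by X, is a multiple of the derivation E or of the second order
  operator D, or vanishes, according to the signs of m and n.\<close>

type_synonym letter = "nat \<times> int"

text \<open>Modes of negative index commute, so a variable is an unordered pair of letters. It is
  named by the representative of the pair in the basis, which for equal colours is the one with
  ordered modes.\<close>

fun nrm :: "letter \<Rightarrow> letter \<Rightarrow> idx" where
  "nrm (i, m) (j, n) =
    (if i < j then (i, j, m, n) else if j < i then (j, i, n, m) else (i, i, min m n, max m n))"

fun la :: "idx \<Rightarrow> letter" where "la (i, j, m, n) = (i, m)"

fun lb :: "idx \<Rightarrow> letter" where "lb (i, j, m, n) = (j, n)"

lemma nrm_commute: "nrm a b = nrm b a"
  by (cases a; cases b) auto

lemma letters_nrm: "la (nrm a b) = a \<and> lb (nrm a b) = b \<or> la (nrm a b) = b \<and> lb (nrm a b) = a"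
  by (cases a; cases b) (auto simp: min_def max_def)

declare nrm.simps [simp del]

definition X :: "letter \<Rightarrow> letter \<Rightarrow> pol" where
  "X a b = var (nrm a b)"

lemma X_commute: "X a b = X b a"
  by (simp add: X_def nrm_commute)

text \<open>A Kronecker delta with values in the polynomials: commutator formulas become identities
  in a commutative ring, which can be normalized without case distinctions.\<close>

definition kd :: "letter \<Rightarrow> letter \<Rightarrow> pol" where
  "kd a b = of_bool (a = b)"

lemma kd_commute: "kd a b = kd b a"
  by (simp add: kd_def eq_commute)

lemma kd_same [simp]: "kd a a = 1"
  by (simp add: kd_def)

lemma kd_neq: "a \<noteq> b \<Longrightarrow> kd a b = 0"
  by (simp add: kd_def)

lemma lin_kd: "lin T \<Longrightarrow> T (kd a b * p) = kd a b * T p"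
  by (simp add: kd_def lin_of_bool del: of_bool_eq_1_iff)

definition E :: "letter \<Rightarrow> letter \<Rightarrow> pol \<Rightarrow> pol" where
  "E a b = der (\<lambda>y. kd (la y) b * X a (lb y) + kd (lb y) b * X a (la y))"

lemma lin_E: "lin (E a b)"
  by (simp add: E_def lin_der)

lemma E_one [simp]: "E a b 1 = 0"
  by (simp add: E_def der_one)

lemma E_var: "E a b (var y * p) =
    var y * E a b p + (kd (la y) b * X a (lb y) + kd (lb y) b * X a (la y)) * p"
  by (simp add: E_def der_var)

lemma E_X: "E a b (X c d * p) = X c d * E a b p + (kd c b * X a d + kd d b * X a c) * p"
  using letters_nrm[of c d] unfolding X_def E_var by (auto simp: algebra_simps)

lemma E_mult: "E a b (p * q) = E a b p * q + p * E a b q"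
  by (simp add: E_def der_mult)

lemmas E_lin = lin_add[OF lin_E] lin_cst[OF lin_E] lin_zero[OF lin_E] lin_diff[OF lin_E]
  lin_minus[OF lin_E] lin_kd[OF lin_E] lin_numeral[OF lin_E]

text \<open>The commutator of a product of two derivatives with a product of two coordinates: the
  terms in \<open>E\<close> come from single contractions, the scalar terms from double
  contractions, each weighted by the level.\<close>

definition D_comm :: "complex \<Rightarrow> letter \<Rightarrow> letter \<Rightarrow> letter \<Rightarrow> letter \<Rightarrow> pol \<Rightarrow> pol" where
  "D_comm r a b c d p =
    kd c b * E d a p + kd d b * E c a p + kd c a * E d b p + kd d a * E c b p
    + cst r * (kd c b * (kd d a * p) + kd d b * (kd c a * p))"

definition D :: "complex \<Rightarrow> letter \<Rightarrow> letter \<Rightarrow> pol \<Rightarrow> pol" where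
  "D r a b = comm_op (\<lambda>y. D_comm r a b (la y) (lb y))"

lemma lin_D: "lin (D r a b)"
  by (simp add: D_def lin_comm_op)

lemma D_one [simp]: "D r a b 1 = 0"
  by (simp add: D_def comm_op_one)

lemma lin_D_comm: "lin (D_comm r a b c d)"
proof (rule linI)
  fix k p
  show "D_comm r a b c d (cst k * p) = cst k * D_comm r a b c d p"
    unfolding D_comm_def E_lin by (simp add: algebra_simps)
qed (simp add: D_comm_def E_lin algebra_simps)

text \<open>Jacobi identity for \<open>D r a b\<close> and two variables, which commute with each
  other. It is the consistency condition under which \<open>comm_op\<close> has the prescribed
  commutators.\<close>

lemma D_comm_symmetric:
  "D_comm r a b (la y) (lb y) (var z * p) + var y * D_comm r a b (la z) (lb z) p
    = D_comm r a b (la z) (lb z) (var y * p) + var z * D_comm r a b (la y) (lb y) p"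
  unfolding D_comm_def E_var by (simp add: algebra_simps kd_commute X_commute)

lemma D_var: "D r a b (var y * p) = var y * D r a b p + D_comm r a b (la y) (lb y) p"
  unfolding D_def by (subst comm_op_var) (simp_all add: lin_D_comm D_comm_symmetric)

lemma D_X: "D r a b (X c d * p) = X c d * D r a b p + D_comm r a b c d p"
  using letters_nrm[of c d] unfolding X_def D_var by (auto simp: D_comm_def algebra_simps)

lemma D_commute: "D r a b p = D r b a p"
proof (rule lin_eqI[OF lin_D lin_D])
  fix y p assume "D r a b p = D r b a p"
  then show "D r a b (var y * p) = D r b a (var y * p)"
    unfolding D_var D_comm_def by (simp add: algebra_simps)
qed simp

lemmas D_lin = lin_add[OF lin_D] lin_cst[OF lin_D] lin_zero[OF lin_D] lin_diff[OF lin_D]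
  lin_minus[OF lin_D] lin_kd[OF lin_D] lin_numeral[OF lin_D]

lemma E_E: "E a b (E c d p) = E c d (E a b p) + kd b c * E a d p - kd a d * E c b p"
proof (induction p rule: pol_induct)
  case (var y p)
  then show ?case
    by (simp add: E_var E_X E_lin distrib_right distrib_left mult.assoc)
      (simp add: algebra_simps kd_commute X_commute)
next
  case (cst k p)
  show ?case unfolding E_lin cst by (simp add: algebra_simps)
qed (simp_all add: E_lin algebra_simps)

text \<open>The commutator consists of further \<open>D\<close> operators. Hence the common kernel
  of the \<open>D\<close> operators is stable under every \<open>E\<close>, and so is the radical
  defined later.\<close>

lemma D_E: "D r a b (E c d p) = E c d (D r a b p) + kd a c * D r b d p + kd b c * D r a d p"
proof (induction p rule: pol_induct)
  case (var y p)
  have 1: "D r a b (E c d (var y * p)) = var y * D r a b (E c d p) + D_comm r a b (la y) (lb y) (E c d p)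
      + kd (la y) d * (X c (lb y) * D r a b p + D_comm r a b c (lb y) p)
      + kd (lb y) d * (X c (la y) * D r a b p + D_comm r a b c (la y) p)"
    by (simp add: E_var D_var D_X D_lin distrib_right mult.assoc)
  have 2: "E c d (D r a b (var y * p)) = var y * E c d (D r a b p)
      + (kd (la y) d * X c (lb y) + kd (lb y) d * X c (la y)) * D r a b p
      + E c d (D_comm r a b (la y) (lb y) p)"
    by (simp add: D_var E_lin E_var)
  \<comment> \<open>Moving \<open>E c d\<close> past the commutator costs brackets from
    \<open>E_E\<close>. The two negative corrections cancel the \<open>D_comm\<close> terms of
    \<open>1\<close> in which \<open>c\<close> has replaced a letter of \<open>y\<close>.\<close>
  have 3: "D_comm r a b (la y) (lb y) (E c d p) = E c d (D_comm r a b (la y) (lb y) p)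
      + kd a c * D_comm r b d (la y) (lb y) p + kd b c * D_comm r a d (la y) (lb y) p
      - kd (la y) d * D_comm r a b c (lb y) p - kd (lb y) d * D_comm r a b c (la y) p"
    unfolding D_comm_def
    by (simp add: E_lin E_E[of c d] distrib_left right_diff_distrib)
      (simp add: algebra_simps kd_commute)
  show ?case
    unfolding 1 2 3 var unfolding D_var by (simp add: algebra_simps)
next
  case (cst k p)
  show ?case unfolding E_lin D_lin cst by (simp add: algebra_simps)
qed (simp_all add: E_lin D_lin algebra_simps)

section \<open>Letters, weights and homogeneous components\<close>

definition VS :: "letter set \<Rightarrow> idx set" where
  "VS S = {nrm a b | a b. a \<in> S \<and> b \<in> S}"

lemma nrm_VS: "a \<in> S \<Longrightarrow> b \<in> S \<Longrightarrow> nrm a b \<in> VS S"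
  unfolding VS_def by blast

lemma VS_E:
  assumes "y \<in> VS S"
  obtains a b where "y = nrm a b" "a \<in> S" "b \<in> S"
  using assms unfolding VS_def by blast

definition Pol :: "letter set \<Rightarrow> pol set" where
  "Pol S = {p. \<forall>\<mu>\<in>keys p. set_mset \<mu> \<subseteq> VS S}"

definition psub :: "pol set \<Rightarrow> bool" where
  "psub W \<longleftrightarrow> 0 \<in> W \<and> (\<forall>p\<in>W. \<forall>q\<in>W. p + q \<in> W) \<and> (\<forall>c. \<forall>p\<in>W. cst c * p \<in> W)"

lemma psub_zero: "psub W \<Longrightarrow> 0 \<in> W"
  and psub_add: "psub W \<Longrightarrow> p \<in> W \<Longrightarrow> q \<in> W \<Longrightarrow> p + q \<in> W"
  and psub_cst: "psub W \<Longrightarrow> p \<in> W \<Longrightarrow> cst c * p \<in> W"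
  by (auto simp: psub_def)

lemma psub_minus: "psub W \<Longrightarrow> p \<in> W \<Longrightarrow> - p \<in> W"
  using psub_cst[of W p "-1"] by (simp add: single_uminus)

lemma psub_diff: "psub W \<Longrightarrow> p \<in> W \<Longrightarrow> q \<in> W \<Longrightarrow> p - q \<in> W"
  using psub_add[of W p "- q"] by (simp add: psub_minus)

lemma psub_sum: "psub W \<Longrightarrow> (\<And>x. x \<in> A \<Longrightarrow> f x \<in> W) \<Longrightarrow> (\<Sum>x\<in>A. f x) \<in> W"
  by (induction A rule: infinite_finite_induct) (auto intro: psub_zero psub_add)

lemma psub_kd: "psub W \<Longrightarrow> p \<in> W \<Longrightarrow> kd a b * p \<in> W"
  by (simp add: kd_def of_bool_def psub_zero)

lemma psub_cancel:
  assumes "psub W" "c \<noteq> 0" "cst c * p \<in> W"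
  shows "p \<in> W"
  using psub_cst[OF assms(1,3), of "1 / c"] assms(2) by (simp add: mult_single flip: mult.assoc)

lemma psub_keys: "psub {p. \<forall>\<mu>\<in>keys p. P \<mu>}"
proof -
  have "P \<mu>" if "\<forall>\<mu>\<in>keys p. P \<mu>" "\<forall>\<mu>\<in>keys q. P \<mu>" "\<mu> \<in> keys (p + q)" for p q \<mu>
    using that keys_add[of p q] by blast
  then show ?thesis by (auto simp: psub_def in_keys_iff)
qed

lemma VS_mono: "S \<subseteq> T \<Longrightarrow> VS S \<subseteq> VS T"
  unfolding VS_def by blast

lemma Pol_mono: "S \<subseteq> T \<Longrightarrow> Pol S \<subseteq> Pol T"
  unfolding Pol_def using VS_mono by blast

lemma psub_Pol: "psub (Pol S)"
  unfolding Pol_def by (rule psub_keys)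

lemma one_Pol: "1 \<in> Pol S"
  by (simp add: Pol_def flip: single_one)

lemma mon_Pol: "mon \<mu> \<in> Pol S \<longleftrightarrow> set_mset \<mu> \<subseteq> VS S"
  by (simp add: Pol_def)

lemma var_Pol: "y \<in> VS S \<Longrightarrow> p \<in> Pol S \<Longrightarrow> var y * p \<in> Pol S"
proof -
  assume y: "y \<in> VS S" and p: "p \<in> Pol S"
  have "z \<in> VS S" if "\<mu> \<in> keys (var y * p)" "z \<in># \<mu>" for \<mu> z
  proof -
    from that(1) have "y \<in># \<mu>" "\<mu> - {#y#} \<in> keys p"
      by (auto simp: in_keys_iff lookup_var_times split: if_splits)
    with p have "set_mset \<mu> \<subseteq> insert y (VS S)"
      unfolding Pol_def using insert_DiffM[of y \<mu>] by (metis (mono_tags) insert_mono mem_Collect_eq set_mset_add_mset_insert)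
    with y that(2) show ?thesis by blast
  qed
  then show ?thesis unfolding Pol_def by blast
qed

lemma X_Pol: "a \<in> S \<Longrightarrow> b \<in> S \<Longrightarrow> p \<in> Pol S \<Longrightarrow> X a b * p \<in> Pol S"
  unfolding X_def by (rule var_Pol) (rule nrm_VS)

lemma Pol_induct [consumes 1, case_names one X add cst]:
  assumes p: "p \<in> Pol S"
    and one: "Q 1"
    and X: "\<And>a b p. a \<in> S \<Longrightarrow> b \<in> S \<Longrightarrow> p \<in> Pol S \<Longrightarrow> Q p \<Longrightarrow> Q (X a b * p)"
    and add: "\<And>p q. p \<in> Pol S \<Longrightarrow> q \<in> Pol S \<Longrightarrow> Q p \<Longrightarrow> Q q \<Longrightarrow> Q (p + q)"
    and cst: "\<And>c p. p \<in> Pol S \<Longrightarrow> Q p \<Longrightarrow> Q (cst c * p)"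
  shows "Q p"
proof -
  have mon: "Q (mon \<mu>)" if "set_mset \<mu> \<subseteq> VS S" for \<mu>
    using that
  proof (induction \<mu>)
    case empty
    show ?case using one by (simp flip: single_one)
  next
    case (add y \<mu>)
    then obtain a b where "y = nrm a b" "a \<in> S" "b \<in> S" by (auto elim: VS_E)
    then show ?case
      using X[of a b "mon \<mu>"] add by (simp add: mon_add_mset X_def mon_Pol)
  qed
  have "finite A \<Longrightarrow> A \<subseteq> keys p \<Longrightarrow> (\<Sum>\<mu>\<in>A. cst (lookup p \<mu>) * mon \<mu>) \<in> Pol S
      \<and> Q (\<Sum>\<mu>\<in>A. cst (lookup p \<mu>) * mon \<mu>)" for A
  proof (induction A rule: finite_induct)
    case empty
    show ?case using cst[OF one_Pol one, of 0] by (simp add: psub_zero[OF psub_Pol])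
  next
    case (insert \<mu> A)
    with p have "set_mset \<mu> \<subseteq> VS S" by (auto simp: Pol_def)
    then have "cst (lookup p \<mu>) * mon \<mu> \<in> Pol S" "Q (cst (lookup p \<mu>) * mon \<mu>)"
      using mon cst mon_Pol psub_cst[OF psub_Pol] by blast+
    with insert show ?case
      by (simp only: sum.insert insert_subset not_False_eq_True simp_thms) (auto intro: add psub_add[OF psub_Pol])
  qed
  from this[of "keys p"] show ?thesis by (simp only: pol_eq_sum[symmetric] finite_keys order_refl)
qed

lemma E_Pol: "p \<in> Pol S \<Longrightarrow> a \<in> S \<Longrightarrow> E a b p \<in> Pol S"
proof (induction p rule: Pol_induct)
  case (X c d p)
  then have "X a d * p \<in> Pol S" "X a c * p \<in> Pol S" "X c d * E a b p \<in> Pol S"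
    by (simp_all add: X_Pol)
  then show ?case
    by (simp add: E_X distrib_right mult.assoc psub_add[OF psub_Pol] psub_kd[OF psub_Pol])
qed (simp_all add: E_lin psub_zero[OF psub_Pol] psub_add[OF psub_Pol] psub_cst[OF psub_Pol])

lemma D_comm_Pol:
  "p \<in> Pol S \<Longrightarrow> c \<in> S \<Longrightarrow> d \<in> S \<Longrightarrow> D_comm r a b c d p \<in> Pol S"
  unfolding D_comm_def
  by (intro psub_add[OF psub_Pol] psub_cst[OF psub_Pol] psub_kd[OF psub_Pol] E_Pol)

lemma D_Pol: "p \<in> Pol S \<Longrightarrow> D r a b p \<in> Pol S"
  by (induction p rule: Pol_induct)
    (simp_all add: D_X D_lin X_Pol D_comm_Pol psub_zero[OF psub_Pol] psub_add[OF psub_Pol]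
      psub_cst[OF psub_Pol])

lemma E_eq_0: "p \<in> Pol S \<Longrightarrow> b \<notin> S \<Longrightarrow> E a b p = 0"
proof (induction p rule: Pol_induct)
  case (X c d p)
  then have "kd c b = 0" "kd d b = 0" by (auto intro!: kd_neq)
  with X show ?case by (simp add: E_X)
qed (simp_all add: E_lin)

lemma D_eq_0: "p \<in> Pol S \<Longrightarrow> b \<notin> S \<Longrightarrow> D r a b p = 0"
proof (induction p rule: Pol_induct)
  case (X c d p)
  then have "kd c b = 0" "kd d b = 0" by (auto intro!: kd_neq)
  with X show ?case by (simp add: D_X D_comm_def E_eq_0)
qed (simp_all add: D_lin)

definition letters :: "pol \<Rightarrow> letter set" where
  "letters p = (\<Union>\<mu>\<in>keys p. la ` set_mset \<mu> \<union> lb ` set_mset \<mu>)"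

lemma finite_letters: "finite (letters p)"
  by (simp add: letters_def)

text \<open>Membership in some \<open>Pol S\<close> guarantees that all indices are normalized, so
  that each is recovered from its two letters. This gives a finite set of letters even if
  \<open>S\<close> is infinite.\<close>

lemma Pol_letters: "p \<in> Pol S \<Longrightarrow> p \<in> Pol (letters p)"
proof -
  assume p: "p \<in> Pol S"
  have "y \<in> VS (letters p)" if "\<mu> \<in> keys p" "y \<in># \<mu>" for \<mu> y
  proof -
    from p that have "y \<in> VS S" unfolding Pol_def by blast
    then obtain a b where y: "y = nrm a b" by (rule VS_E)
    have "la y \<in> letters p" "lb y \<in> letters p"
      using that unfolding letters_def by blast+
    with y show ?thesis
      using letters_nrm[of a b] nrm_VS[of a "letters p" b] by auto
  qed
  then show ?thesis unfolding Pol_def by blast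
qed

lemma letters_Pol: "p \<in> Pol S \<Longrightarrow> letters p \<subseteq> S"
proof
  fix a assume "p \<in> Pol S" "a \<in> letters p"
  then obtain y where "y \<in> VS S" "a = la y \<or> a = lb y"
    unfolding letters_def Pol_def by blast
  moreover then obtain c d where "y = nrm c d" "c \<in> S" "d \<in> S" by (auto elim: VS_E)
  ultimately have "c \<in> S" "d \<in> S" "a = la (nrm c d) \<or> a = lb (nrm c d)"
    by simp_all
  with letters_nrm[of c d] show "a \<in> S" by auto
qed

text \<open>The weight of a letter is left open because three gradings are needed: the degree in one
  letter, the number of letters, and the total mode number of one colour.\<close>

definition wt :: "(letter \<Rightarrow> int) \<Rightarrow> idx multiset \<Rightarrow> int" where
  "wt w \<mu> = (\<Sum>y\<in>#\<mu>. w (la y) + w (lb y))"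

lemma wt_add_mset [simp]: "wt w (add_mset y \<mu>) = w (la y) + w (lb y) + wt w \<mu>"
  by (simp add: wt_def)

lemma wt_nonneg: "(\<And>a. w a \<ge> 0) \<Longrightarrow> wt w \<mu> \<ge> 0"
  by (induction \<mu>) (simp_all add: wt_def add_increasing)

definition hom :: "(letter \<Rightarrow> int) \<Rightarrow> int \<Rightarrow> pol set" where
  "hom w c = {p. \<forall>\<mu>\<in>keys p. wt w \<mu> = c}"

lemma psub_hom: "psub (hom w c)"
  unfolding hom_def by (rule psub_keys)

lemma mon_hom: "mon \<mu> \<in> hom w (wt w \<mu>)"
  by (simp add: hom_def)

lemma var_hom: "p \<in> hom w k \<Longrightarrow> var y * p \<in> hom w (w (la y) + w (lb y) + k)"
  unfolding hom_def
  by (auto simp: in_keys_iff lookup_var_times split: if_splits dest!: multi_member_split)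

lemma X_hom: "p \<in> hom w k \<Longrightarrow> X a b * p \<in> hom w (w a + w b + k)"
  using var_hom[of p w k "nrm a b"] letters_nrm[of a b] by (auto simp: X_def add_ac)

lemma hom_lin:
  assumes T: "lin T" and mon: "\<And>\<mu>. T (mon \<mu>) \<in> hom w (wt w \<mu> + k)" and p: "p \<in> hom w c"
  shows "T p \<in> hom w (c + k)"
proof -
  have "cst (lookup p \<mu>) * T (mon \<mu>) \<in> hom w (c + k)" if "\<mu> \<in> keys p" for \<mu>
    using that p mon[of \<mu>] psub_cst[OF psub_hom] by (auto simp: hom_def[of w c])
  then have "(\<Sum>\<mu>\<in>keys p. cst (lookup p \<mu>) * T (mon \<mu>)) \<in> hom w (c + k)"
    by (rule psub_sum[OF psub_hom])
  also have "(\<Sum>\<mu>\<in>keys p. cst (lookup p \<mu>) * T (mon \<mu>)) = T p"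
    by (subst (2) pol_eq_sum) (simp only: lin_sum[OF T] lin_cst[OF T])
  finally show ?thesis .
qed

lemma hom_kd: "(a = b \<Longrightarrow> p \<in> hom w c) \<Longrightarrow> kd a b * p \<in> hom w c"
  by (cases "a = b") (simp_all add: kd_neq psub_zero[OF psub_hom])

lemma E_hom: "p \<in> hom w c \<Longrightarrow> E a b p \<in> hom w (c + (w a - w b))"
proof (rule hom_lin[OF lin_E])
  fix \<mu> show "E a b (mon \<mu>) \<in> hom w (wt w \<mu> + (w a - w b))"
  proof (induction \<mu>)
    case empty
    show ?case by (simp add: psub_zero[OF psub_hom])
  next
    case (add y \<mu>)
    have "var y * E a b (mon \<mu>) \<in> hom w (wt w (add_mset y \<mu>) + (w a - w b))"
      using var_hom[OF add, of y] by (simp add: add_ac add_diff_eq)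
    moreover have "kd (la y) b * (X a (lb y) * mon \<mu>) \<in> hom w (wt w (add_mset y \<mu>) + (w a - w b))"
      using X_hom[OF mon_hom, of a "lb y" \<mu> w] by (intro hom_kd) (simp add: algebra_simps)
    moreover have "kd (lb y) b * (X a (la y) * mon \<mu>) \<in> hom w (wt w (add_mset y \<mu>) + (w a - w b))"
      using X_hom[OF mon_hom, of a "la y" \<mu> w] by (intro hom_kd) (simp add: algebra_simps)
    ultimately show ?case
      unfolding mon_add_mset E_var distrib_right mult.assoc by (intro psub_add[OF psub_hom])
  qed
qed

lemma D_comm_hom:
  assumes "p \<in> hom w k"
  shows "D_comm r a b c d p \<in> hom w (w c + w d + k - (w a + w b))"
  unfolding D_comm_def
proof (intro psub_add[OF psub_hom] psub_cst[OF psub_hom] hom_kd)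
  assume "c = b"
  with E_hom[OF assms, of d a] show "E d a p \<in> hom w (w c + w d + k - (w a + w b))"
    by (simp add: algebra_simps)
next
  assume "d = b"
  with E_hom[OF assms, of c a] show "E c a p \<in> hom w (w c + w d + k - (w a + w b))"
    by (simp add: algebra_simps)
next
  assume "c = a"
  with E_hom[OF assms, of d b] show "E d b p \<in> hom w (w c + w d + k - (w a + w b))"
    by (simp add: algebra_simps)
next
  assume "d = a"
  with E_hom[OF assms, of c b] show "E c b p \<in> hom w (w c + w d + k - (w a + w b))"
    by (simp add: algebra_simps)
qed (use assms in \<open>simp_all add: algebra_simps\<close>)

lemma D_hom: "p \<in> hom w c \<Longrightarrow> D r a b p \<in> hom w (c + - (w a + w b))"
proof (rule hom_lin[OF lin_D])
  fix \<mu> show "D r a b (mon \<mu>) \<in> hom w (wt w \<mu> + - (w a + w b))"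
  proof (induction \<mu>)
    case empty
    show ?case by (simp add: psub_zero[OF psub_hom])
  next
    case (add y \<mu>)
    have "var y * D r a b (mon \<mu>) \<in> hom w (wt w (add_mset y \<mu>) + - (w a + w b))"
      using var_hom[OF add, of y] by (simp add: algebra_simps)
    moreover have "D_comm r a b (la y) (lb y) (mon \<mu>) \<in> hom w (wt w (add_mset y \<mu>) + - (w a + w b))"
      using D_comm_hom[OF mon_hom, of r a b "la y" "lb y" \<mu> w] by (simp add: algebra_simps)
    ultimately show ?case
      unfolding mon_add_mset D_var by (intro psub_add[OF psub_hom])
  qed
qed

definition prj :: "(letter \<Rightarrow> int) \<Rightarrow> int \<Rightarrow> pol \<Rightarrow> pol" where
  "prj w c p = (\<Sum>\<mu>\<in>{\<mu>\<in>keys p. wt w \<mu> = c}. cst (lookup p \<mu>) * mon \<mu>)"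

lemma lookup_prj: "lookup (prj w c p) \<nu> = (if wt w \<nu> = c then lookup p \<nu> else 0)"
proof -
  have "lookup (prj w c p) \<nu> = (\<Sum>\<mu>\<in>{\<mu>\<in>keys p. wt w \<mu> = c}. lookup p \<mu> * lookup (mon \<mu>) \<nu>)"
    unfolding prj_def by (simp only: lookup_sum lookup_cst_times)
  also have "\<dots> = (\<Sum>\<mu>\<in>{\<mu>\<in>keys p. wt w \<mu> = c}. if \<nu> = \<mu> then lookup p \<mu> else 0)"
    by (intro sum.cong) (auto simp: lookup_single)
  finally show ?thesis by (auto simp: in_keys_iff)
qed

lemma prj_hom: "prj w c p \<in> hom w c"
  by (auto simp: hom_def in_keys_iff lookup_prj split: if_splits)

lemma prj_eq: "p \<in> hom w k \<Longrightarrow> prj w c p = (if c = k then p else 0)"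
  by (intro poly_mapping_eqI) (auto simp: lookup_prj hom_def in_keys_iff)

lemma lin_prj: "lin (prj w c)"
  by (intro linI poly_mapping_eqI) (auto simp: lookup_prj lookup_add)

lemma sum_prj: "p = (\<Sum>c\<in>wt w ` keys p. prj w c p)"
proof (rule poly_mapping_eqI)
  fix \<nu>
  have "lookup (\<Sum>c\<in>wt w ` keys p. prj w c p) \<nu>
      = (\<Sum>c\<in>wt w ` keys p. if wt w \<nu> = c then lookup p \<nu> else 0)"
    by (simp only: lookup_sum lookup_prj)
  then show "lookup p \<nu> = lookup (\<Sum>c\<in>wt w ` keys p. prj w c p) \<nu>"
    by (auto simp: in_keys_iff)
qed

text \<open>A subspace stable under a diagonalizable operator contains the eigencomponents of its
  members; unwanted eigenvalues are removed one by one.\<close>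

lemma prj_mem:
  assumes W: "psub W" and T: "\<And>p. p \<in> W \<Longrightarrow> T p \<in> W"
    and diag: "\<And>p \<mu>. p \<in> W \<Longrightarrow> lookup (T p) \<mu> = of_int (wt w \<mu>) * lookup p \<mu>"
    and p: "p \<in> W"
  shows "prj w c p \<in> W"
  using p
proof (induction "card (wt w ` keys p)" arbitrary: p rule: less_induct)
  case less
  show ?case
  proof (cases "wt w ` keys p \<subseteq> {c}")
    case True
    then have "p \<in> hom w c" by (auto simp: hom_def)
    with less.prems show ?thesis by (simp add: prj_eq)
  next
    case False
    then obtain e where e: "e \<in> wt w ` keys p" "e \<noteq> c" by auto
    \<comment> \<open>This kills the component of weight \<open>e\<close> and multiplies the one of
      weight \<open>c\<close> by the nonzero number \<open>c - e\<close>, so the induction applies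
      to \<open>q\<close> and its conclusion can be divided.\<close>
    define q where "q = T p - cst (of_int e) * p"
    have lq: "lookup q \<mu> = (of_int (wt w \<mu>) - of_int e) * lookup p \<mu>" for \<mu>
      unfolding q_def lookup_minus lookup_cst_times diag[OF less.prems] by (simp add: algebra_simps)
    have qW: "q \<in> W"
      unfolding q_def using less.prems by (intro psub_diff psub_cst W T)
    have "wt w ` keys q \<subseteq> wt w ` keys p" "e \<notin> wt w ` keys q"
      by (auto simp: in_keys_iff lq)
    then have "wt w ` keys q \<subset> wt w ` keys p" using e by blast
    then have "card (wt w ` keys q) < card (wt w ` keys p)"
      by (intro psubset_card_mono) auto
    then have "prj w c q \<in> W" by (rule less.hyps) (rule qW)
    moreover have "prj w c q = cst (of_int (c - e)) * prj w c p"
      by (intro poly_mapping_eqI) (simp add: lookup_prj lq)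
    ultimately show ?thesis
      using psub_cancel[OF W, of "of_int (c - e)" "prj w c p"] e by simp
  qed
qed

lemma diagonal_operator:
  assumes lin: "lin T" and one: "T 1 = 0"
    and X: "\<And>a b p. a \<in> S \<Longrightarrow> b \<in> S \<Longrightarrow> p \<in> Pol S \<Longrightarrow>
      T (X a b * p) = X a b * T p + cst (of_int (w a + w b)) * (X a b * p)"
    and p: "p \<in> Pol S"
  shows "lookup (T p) \<mu> = of_int (wt w \<mu>) * lookup p \<mu>"
proof -
  have mon: "T (mon \<mu>) = cst (of_int (wt w \<mu>)) * mon \<mu>" if "set_mset \<mu> \<subseteq> VS S" for \<mu>
    using that
  proof (induction \<mu>)
    case empty
    show ?case using one by (simp add: wt_def)
  next
    case (add y \<mu>)
    then obtain a b where y: "y = nrm a b" "a \<in> S" "b \<in> S" by (auto elim: VS_E)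
    have w: "w (la y) + w (lb y) = w a + w b"
      using letters_nrm[of a b] y by auto
    have "T (mon (add_mset y \<mu>)) = X a b * T (mon \<mu>) + cst (of_int (w a + w b)) * (X a b * mon \<mu>)"
      using X[of a b "mon \<mu>"] y add by (simp only: mon_add_mset X_def mon_Pol) simp
    also have "\<dots> = cst (of_int (wt w (add_mset y \<mu>))) * mon (add_mset y \<mu>)"
    proof -
      have "T (mon \<mu>) = cst (of_int (wt w \<mu>)) * mon \<mu>"
        using add by simp
      moreover have "cst (of_int (wt w (add_mset y \<mu>))) = (cst (of_int (w a + w b)) + cst (of_int (wt w \<mu>)) :: pol)"
        unfolding wt_add_mset w single_add[symmetric] by (simp add: add_ac)
      ultimately show ?thesis
        unfolding mon_add_mset X_def y(1) by (simp add: algebra_simps)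
    qed
    finally show ?case .
  qed
  have "T p = (\<Sum>\<mu>\<in>keys p. cst (lookup p \<mu>) * T (mon \<mu>))"
    by (subst pol_eq_sum) (simp only: lin_sum[OF lin] lin_cst[OF lin])
  also have "\<dots> = (\<Sum>\<mu>\<in>keys p. cst (lookup p \<mu>) * (cst (of_int (wt w \<mu>)) * mon \<mu>))"
    using p by (intro sum.cong) (auto simp: Pol_def mon)
  finally have "T p = (\<Sum>\<mu>\<in>keys p. cst (lookup p \<mu>) * (cst (of_int (wt w \<mu>)) * mon \<mu>))" .
  then have "lookup (T p) \<mu> = (\<Sum>\<nu>\<in>keys p. lookup p \<nu> * (of_int (wt w \<nu>) * lookup (mon \<nu>) \<mu>))"
    by (simp only: lookup_sum lookup_cst_times)
  also have "\<dots> = (\<Sum>\<nu>\<in>keys p. if \<mu> = \<nu> then of_int (wt w \<nu>) * lookup p \<nu> else 0)"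
    by (intro sum.cong) (auto simp: lookup_single)
  finally show ?thesis by (auto simp: in_keys_iff)
qed

lemma E_diagonal:
  assumes "p \<in> Pol S"
  shows "lookup (E a a p) \<mu> = of_int (wt (\<lambda>b. of_bool (b = a)) \<mu>) * lookup p \<mu>"
proof (rule diagonal_operator[OF lin_E _ _ assms])
  fix c d p
  have "cst (of_int (of_bool (c = a) + of_bool (d = a))) = (kd c a + kd d a :: pol)"
    by (cases "c = a"; cases "d = a") (simp_all add: kd_neq)
  moreover have "kd c a * X a d = kd c a * X c d" "kd d a * X a c = kd d a * X c d"
    by (cases "c = a"; cases "d = a"; simp add: kd_neq X_commute)+
  ultimately show "E a a (X c d * p)
      = X c d * E a a p + cst (of_int (of_bool (c = a) + of_bool (d = a))) * (X c d * p)"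
    unfolding E_X by (simp only: distrib_right mult.assoc[symmetric])
qed simp

section \<open>Irreducibility for non-integral level\<close>

lemma sum_kd: "finite S \<Longrightarrow> e \<in> S \<Longrightarrow> (\<Sum>a\<in>S. kd e a * g a) = g e"
proof -
  assume "finite S" "e \<in> S"
  then have "(\<Sum>a\<in>S. kd e a * g a) = (\<Sum>a\<in>S. if e = a then g a else 0)"
    by (intro sum.cong) (auto simp: kd_neq)
  also have "\<dots> = g e" using \<open>finite S\<close> \<open>e \<in> S\<close> by simp
  finally show ?thesis .
qed

text \<open>For oscillators the difference of the two sides is a combination of infinitesimal
  rotations of the components, and these kill every polynomial in the \<open>X\<close>. The direct
  proof works since the contribution of a new factor \<open>X e f\<close> is symmetric in
  \<open>p\<close> and \<open>q\<close>.\<close>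

lemma sum_X_E_commute:
  assumes S: "finite S" and u: "u \<in> Pol S"
  shows "(\<Sum>a\<in>S. X p a * E q a u) = (\<Sum>a\<in>S. X q a * E p a u)"
  using u
proof (induction u rule: Pol_induct)
  case (X e f u)
  have *: "(\<Sum>a\<in>S. X p a * E q a (X e f * u))
      = X e f * (\<Sum>a\<in>S. X p a * E q a u) + (X p e * X q f + X p f * X q e) * u" for p q
  proof -
    have "(\<Sum>a\<in>S. X p a * E q a (X e f * u))
      = (\<Sum>a\<in>S. X e f * (X p a * E q a u) + kd e a * (X p a * (X q f * u))
          + kd f a * (X p a * (X q e * u)))"
      unfolding E_X by (simp add: algebra_simps)
    also have "\<dots> = X e f * (\<Sum>a\<in>S. X p a * E q a u) + X p e * (X q f * u) + X p f * (X q e * u)"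
      unfolding sum.distrib sum_distrib_left[symmetric] sum_kd[OF S X(1)] sum_kd[OF S X(2)] ..
    finally show ?thesis by (simp add: algebra_simps)
  qed
  show ?case unfolding * X.IH by (simp add: algebra_simps)
next
  case (cst c u)
  have *: "(\<Sum>a\<in>S. X p a * E q a (cst c * u)) = cst c * (\<Sum>a\<in>S. X p a * E q a u)" for p q
    by (simp add: E_lin sum_distrib_left mult.left_commute)
  show ?case unfolding * cst by simp
qed (simp_all add: E_lin distrib_left sum.distrib)

text \<open>The constant can be read off from the double contractions with a factor
  \<open>X c d\<close>: the left side yields r of them, the products of two \<open>E\<close> yield
  one for each \<open>a\<close> in \<open>S\<close> and one more. The other terms match by
  \<open>sum_X_E_commute\<close>.\<close>

lemma sum_X_D:
  assumes S: "finite S" and u: "u \<in> Pol S"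
  shows "(\<Sum>a\<in>S. X p a * D r a q u)
    = (\<Sum>a\<in>S. E p a (E a q u)) + cst (r - 1 - of_nat (card S)) * E p q u"
  using u
proof (induction u rule: Pol_induct)
  case (X c d u)
  let ?k = "cst (r - 1 - of_nat (card S)) :: pol"
  have EE: "E p a (E a q (X c d * u)) = X c d * E p a (E a q u)
      + kd c a * (X p d * E a q u) + kd d a * (X p c * E a q u)
      + kd c q * (X d a * E p a u) + kd d q * (X c a * E p a u)
      + (kd c q * X p d + kd d q * X p c) * u
      + kd d a * (kd c q * (X p a * u)) + kd c a * (kd d q * (X p a * u))" for a
    by (simp add: E_X E_lin distrib_right mult.assoc) (simp add: algebra_simps X_commute)
  have sE: "(\<Sum>a\<in>S. E p a (E a q (X c d * u))) = X c d * (\<Sum>a\<in>S. E p a (E a q u))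
      + X p d * E c q u + X p c * E d q u
      + kd c q * (\<Sum>a\<in>S. X d a * E p a u) + kd d q * (\<Sum>a\<in>S. X c a * E p a u)
      + of_nat (card S) * ((kd c q * X p d + kd d q * X p c) * u)
      + (kd c q * X p d + kd d q * X p c) * u"
    unfolding EE sum.distrib sum_distrib_left[symmetric] sum_kd[OF S X(1)] sum_kd[OF S X(2)]
    by (simp add: algebra_simps)
  have XD: "X p a * D r a q (X c d * u) = X c d * (X p a * D r a q u)
      + kd c q * (X p a * E d a u) + kd d q * (X p a * E c a u)
      + kd c a * (X p a * E d q u) + kd d a * (X p a * E c q u)
      + kd d a * (cst r * (kd c q * (X p a * u))) + kd c a * (cst r * (kd d q * (X p a * u)))" for a
    unfolding D_X D_comm_def by (simp add: algebra_simps)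
  have sD: "(\<Sum>a\<in>S. X p a * D r a q (X c d * u)) = X c d * (\<Sum>a\<in>S. X p a * D r a q u)
      + kd c q * (\<Sum>a\<in>S. X p a * E d a u) + kd d q * (\<Sum>a\<in>S. X p a * E c a u)
      + X p c * E d q u + X p d * E c q u + cst r * ((kd c q * X p d + kd d q * X p c) * u)"
    unfolding XD sum.distrib sum_distrib_left[symmetric] sum_kd[OF S X(1)] sum_kd[OF S X(2)]
    by (simp add: algebra_simps)
  have k: "?k = cst r - 1 - of_nat (card S)"
    by (simp add: single_diff)
  show ?case
    unfolding sE sD X.IH unfolding E_X sum_X_E_commute[OF S X(3), of d p] sum_X_E_commute[OF S X(3), of c p] k
    by (simp add: algebra_simps)
next
  case (add u v)
  then show ?case by (simp add: E_lin D_lin distrib_left sum.distrib)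
next
  case (cst c u)
  have 1: "(\<Sum>a\<in>S. X p a * D r a q (cst c * u)) = cst c * (\<Sum>a\<in>S. X p a * D r a q u)"
    by (simp add: D_lin sum_distrib_left mult.left_commute)
  have 2: "(\<Sum>a\<in>S. E p a (E a q (cst c * u))) = cst c * (\<Sum>a\<in>S. E p a (E a q u))"
    unfolding E_lin sum_distrib_left ..
  show ?case unfolding 1 2 cst unfolding E_lin by (simp add: algebra_simps)
qed (simp add: E_lin)

lemma lookup_E_empty: "lookup (E a b p) {#} = 0"
  by (induction p rule: pol_induct)
    (simp_all add: E_lin E_var lookup_add distrib_right mult.assoc lookup_var_times X_def
      lookup_cst_times kd_def of_bool_def)

lemma Pol_empty_eq: "p \<in> Pol {} \<Longrightarrow> p = cst (lookup p {#})"
  by (rule poly_mapping_eqI) (auto simp: lookup_single when_def Pol_def VS_def in_keys_iff)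

lemma hom_zero_Pol:
  assumes p: "p \<in> Pol (insert N S)" and hom: "p \<in> hom (\<lambda>b. of_bool (b = N)) 0"
  shows "p \<in> Pol S"
proof -
  have "y \<in> VS S" if \<mu>: "\<mu> \<in> keys p" and y: "y \<in># \<mu>" for \<mu> y
  proof -
    from \<mu> p y have "y \<in> VS (insert N S)" unfolding Pol_def by blast
    then obtain a b where ab: "y = nrm a b" "a \<in> insert N S" "b \<in> insert N S" by (rule VS_E)
    obtain \<nu> where \<nu>: "\<mu> = add_mset y \<nu>" using y by (blast dest: multi_member_split)
    have "wt (\<lambda>b. of_bool (b = N)) \<mu> = 0" using hom \<mu> by (auto simp: hom_def)
    moreover have "wt (\<lambda>b. of_bool (b = N)) \<nu> \<ge> 0" by (rule wt_nonneg) simp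
    ultimately have "la y \<noteq> N" "lb y \<noteq> N"
      unfolding \<nu> wt_add_mset by (auto simp: of_bool_def split: if_splits)
    with ab letters_nrm[of a b] show ?thesis by (auto intro!: nrm_VS)
  qed
  then show ?thesis unfolding Pol_def by blast
qed

text \<open>Letters are adjoined one at a time, and for a new letter \<open>N\<close> an inner
  induction runs over the degree in \<open>N\<close>. Since the kernel is stable under
  \<open>E\<close>, the operators \<open>E a N\<close> lead to kernel vectors of smaller
  degree.\<close>

lemma D_kernel:
  assumes r: "r \<notin> \<int>" and "finite S" and "f \<in> Pol S" and "\<And>a b. a \<in> S \<Longrightarrow> b \<in> S \<Longrightarrow> D r a b f = 0"
  shows "f \<in> Pol {}"
  using assms(2-)
proof (induction S arbitrary: f rule: finite_induct)
  case (insert N S)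
  define T where "T = insert N S"
  define w :: "letter \<Rightarrow> int" where "w = (\<lambda>b. of_bool (b = N))"
  define K where "K = {g \<in> Pol T. \<forall>a\<in>T. \<forall>b\<in>T. D r a b g = 0}"
  have finT: "finite T" using insert.hyps by (simp add: T_def)
  have K: "psub K"
    using psub_Pol[of T] by (auto simp: psub_def K_def D_lin)
  have K_E: "E a b g \<in> K" if "g \<in> K" "a \<in> T" "b \<in> T" for a b g
    using that by (auto simp: K_def E_Pol D_E E_lin)
  have diag: "lookup (E N N g) \<mu> = of_int (wt w \<mu>) * lookup g \<mu>" if "g \<in> K" for g \<mu>
    using that E_diagonal[of g T N \<mu>] by (simp add: K_def w_def)
  have step: "g \<in> Pol {}" if "g \<in> K" "g \<in> hom w (int n)" for g n
    using that
  proof (induction n arbitrary: g)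
    case 0
    then have "g \<in> Pol S"
      using hom_zero_Pol[of g N S] by (simp add: K_def T_def w_def)
    then show ?case
      using 0 by (intro insert.IH) (auto simp: K_def T_def)
  next
    case (Suc n)
    \<comment> \<open>The inner induction makes this vector constant, and no \<open>E\<close>
      produces a constant term.\<close>
    have E0: "E a N g = 0" if "a \<in> S" for a
    proof -
      have "a \<noteq> N" using that insert.hyps by auto
      then have "E a N g \<in> hom w (int n)"
        using E_hom[OF Suc.prems(2), of a N] by (simp add: w_def)
      moreover have "E a N g \<in> K" using K_E[OF Suc.prems(1)] that by (simp add: T_def)
      ultimately have "E a N g \<in> Pol {}" using Suc.IH by blast
      then show ?thesis using Pol_empty_eq[of "E a N g"] by (simp add: lookup_E_empty)
    qed
    have ENN: "E N N g = cst (of_nat (Suc n)) * g"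
    proof (rule poly_mapping_eqI)
      fix \<mu>
      show "lookup (E N N g) \<mu> = lookup (cst (of_nat (Suc n)) * g) \<mu>"
      proof (cases "\<mu> \<in> keys g")
        case True
        then have "wt w \<mu> = int (Suc n)" using Suc.prems(2) by (simp add: hom_def)
        then show ?thesis by (simp only: diag[OF Suc.prems(1)] lookup_cst_times of_int_of_nat_eq)
      next
        case False
        then show ?thesis by (simp only: diag[OF Suc.prems(1)] lookup_cst_times in_keys_iff) simp
      qed
    qed
    have gT: "g \<in> Pol T" using Suc.prems by (simp add: K_def)
    have "D r a N g = 0" if "a \<in> T" for a
      using Suc.prems(1) that by (auto simp: K_def T_def)
    then have "0 = (\<Sum>a\<in>T. X N a * D r a N g)"
      by simp
    also have "\<dots> = (\<Sum>a\<in>T. E N a (E a N g)) + cst (r - 1 - of_nat (card T)) * E N N g"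
      by (rule sum_X_D[OF finT gT])
    also have "(\<Sum>a\<in>T. E N a (E a N g)) = E N N (E N N g)"
      using insert.hyps by (simp add: T_def E0 E_lin)
    also have "E N N (E N N g) + cst (r - 1 - of_nat (card T)) * E N N g
        = cst (of_nat (Suc n) * (of_nat (Suc n) + r - 1 - of_nat (card T))) * g"
      unfolding ENN E_lin
      by (simp only: mult.assoc[symmetric] distrib_right[symmetric] mult_single single_add[symmetric] add_0)
        (simp add: algebra_simps)
    finally have "cst (of_nat (Suc n) * (of_nat (Suc n) + r - 1 - of_nat (card T))) * g = 0"
      by simp
    moreover have "of_nat (Suc n) + r - 1 - of_nat (card T) \<noteq> 0"
    proof
      assume "of_nat (Suc n) + r - 1 - of_nat (card T) = 0"
      then have "r = of_int (int (card T) - int n)"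
        by (simp add: algebra_simps)
      with r show False by (metis Ints_of_int)
    qed
    then have "of_nat (Suc n) * (of_nat (Suc n) + r - 1 - of_nat (card T)) \<noteq> 0"
      using of_nat_neq_0 mult_eq_0_iff by metis
    ultimately have "g = 0"
      using cst_times_eq_0_iff by blast
    then show ?case by (simp add: psub_zero[OF psub_Pol])
  qed
  have f: "f \<in> K" using insert.prems by (simp add: K_def T_def)
  have "prj w c f \<in> Pol {}" if c: "c \<in> wt w ` keys f" for c
  proof -
    have "c \<ge> 0" using c by (auto simp: w_def intro!: wt_nonneg)
    then have "prj w c f \<in> hom w (int (nat c))" using prj_hom[of w c f] by simp
    moreover have "prj w c f \<in> K"
      by (rule prj_mem[OF K _ diag f]) (auto simp: K_E T_def)
    ultimately show ?thesis by (intro step)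
  qed
  then have "(\<Sum>c\<in>wt w ` keys f. prj w c f) \<in> Pol {}"
    by (rule psub_sum[OF psub_Pol])
  then show ?case by (simp flip: sum_prj)
qed

lemma D_weight_le:
  assumes "\<And>\<mu>. \<mu> \<in> keys p \<Longrightarrow> wt w \<mu> \<le> n" and "\<nu> \<in> keys (D r a b p)"
  shows "wt w \<nu> \<le> n - (w a + w b)"
proof -
  let ?W = "{q. \<forall>\<mu>\<in>keys q. wt w \<mu> \<le> n - (w a + w b)}"
  have "D r a b (prj w c p) \<in> ?W" if "c \<in> wt w ` keys p" for c
    using that assms(1) D_hom[OF prj_hom, of r a b w c p] by (fastforce simp: hom_def)
  then have "(\<Sum>c\<in>wt w ` keys p. D r a b (prj w c p)) \<in> ?W"
    by (rule psub_sum[OF psub_keys])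
  then have "D r a b p \<in> ?W"
    by (simp flip: lin_sum[OF lin_D] sum_prj)
  with assms(2) show ?thesis by simp
qed

text \<open>Each \<open>D\<close> removes two letters, so applying them to a nonzero vector as long
  as possible ends in the common kernel, at a nonzero constant. Multiplication by the variables then
  produces everything.\<close>

lemma Pol_irreducible:
  assumes r: "r \<notin> \<int>" and W: "psub W" "W \<subseteq> Pol S" "W \<noteq> {0}"
    and X: "\<And>a b p. a \<in> S \<Longrightarrow> b \<in> S \<Longrightarrow> p \<in> W \<Longrightarrow> X a b * p \<in> W"
    and D: "\<And>a b p. a \<in> S \<Longrightarrow> b \<in> S \<Longrightarrow> p \<in> W \<Longrightarrow> D r a b p \<in> W"
  shows "W = Pol S"
proof -
  have step: "1 \<in> W" if "f \<in> W" "f \<noteq> 0" "\<And>\<mu>. \<mu> \<in> keys f \<Longrightarrow> wt (\<lambda>_. 1) \<mu> \<le> int n" for f n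
    using that
  proof (induction n arbitrary: f rule: less_induct)
    case (less n)
    have fS: "f \<in> Pol S" using less.prems W by blast
    show ?case
    proof (cases "\<forall>a\<in>S. \<forall>b\<in>S. D r a b f = 0")
      case True
      \<comment> \<open>\<open>S\<close> may be infinite, so \<open>D_kernel\<close> is applied to
        the finitely many letters of \<open>f\<close>.\<close>
      have "f \<in> Pol {}"
        using True letters_Pol[OF fS]
        by (intro D_kernel[OF r finite_letters Pol_letters[OF fS]]) auto
      then have f: "f = cst (lookup f {#})" by (rule Pol_empty_eq)
      with less.prems have "lookup f {#} \<noteq> 0" by (metis single_zero)
      moreover have "cst (lookup f {#}) * 1 \<in> W" using f less.prems by simp
      ultimately show ?thesis by (rule psub_cancel[OF W(1)])
    next
      case False
      then obtain a b where ab: "a \<in> S" "b \<in> S" "D r a b f \<noteq> 0" by blast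
      have le: "wt (\<lambda>_. 1) \<nu> \<le> int n - 2" if "\<nu> \<in> keys (D r a b f)" for \<nu>
        using D_weight_le[OF less.prems(3) that] by simp
      obtain \<nu> where "\<nu> \<in> keys (D r a b f)"
        using ab(3) by (metis all_not_in_conv keys_eq_empty)
      with le[of \<nu>] wt_nonneg[of "\<lambda>_. 1" \<nu>] have "n \<ge> 2" by simp
      then show ?thesis
        using ab less.prems(1) le D by (intro less.IH[of "n - 2" "D r a b f"]) auto
    qed
  qed
  obtain f where f: "f \<in> W" "f \<noteq> 0" using W psub_zero by blast
  have "wt (\<lambda>_. 1) \<mu> \<le> int (nat (Max (wt (\<lambda>_. 1) ` keys f)))" if "\<mu> \<in> keys f" for \<mu>
  proof -
    have "wt (\<lambda>_. 1) \<mu> \<le> Max (wt (\<lambda>_. 1) ` keys f)" using that by simp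
    also have "\<dots> \<le> int (nat \<dots>)" by simp
    finally show ?thesis .
  qed
  then have one: "1 \<in> W" by (rule step[OF f])
  have "p \<in> W" if "p \<in> Pol S" for p
    using that by (induction p rule: Pol_induct) (auto intro: one X psub_add[OF W(1)] psub_cst[OF W(1)])
  with W show ?thesis by blast
qed

section \<open>Singular vectors and the radical for integral level\<close>

text \<open>By \<open>D_E\<close>, commuting \<open>D r c c\<close> with \<open>E c b\<close> gives
  twice \<open>D r c b\<close>, and commuting \<open>D r c b\<close> with \<open>E c a\<close> gives
  \<open>D r b a\<close>. One second order operator thus controls all of them.\<close>

lemma D_eq_0_all:
  assumes p: "p \<in> Pol S" and c: "c \<in> S" "D r c c p = 0"
    and E: "\<And>a. a \<in> S \<Longrightarrow> a \<noteq> c \<Longrightarrow> E c a p = 0"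
  shows "D r a b p = 0"
proof -
  have Dc: "D r c b p = 0" if "b \<in> S" for b
  proof (cases "b = c")
    case False
    then have "0 = D r c c (E c b p)" using E that by (simp add: D_lin)
    also have "\<dots> = 2 * D r c b p" unfolding D_E c(2) by (simp add: E_lin)
    finally show ?thesis by simp
  qed (use c in simp)
  have DS: "D r a b p = 0" if ab: "a \<in> S" "b \<in> S" for a b
  proof (cases "a = c \<or> b = c")
    case True
    then show ?thesis using Dc ab by (metis D_commute)
  next
    case False
    then have "0 = D r c b (E c a p)" using E ab by (simp add: D_lin)
    also have "\<dots> = D r b a p" unfolding D_E Dc[OF ab(2)] using False by (simp add: E_lin kd_neq)
    finally show ?thesis by (simp add: D_commute)
  qed
  show ?thesis
    using DS D_eq_0[OF p] D_commute by metis
qed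

text \<open>Each \<open>E c j\<close> lowers the degree in \<open>j\<close> by one, and
  \<open>p\<close> has degree 2; after three steps the degree would be -1.\<close>

lemma E_E_E_eq_0:
  assumes p: "p \<in> Pol S" "c \<in> S" and jc: "j \<noteq> c" and E: "E j j p = 2 * p"
  shows "E c j (E c j (E c j p)) = 0"
proof -
  let ?q = "E c j (E c j (E c j p))"
  have step: "E j j (E c j q) = E c j (E j j q) - E c j q" for q
    using jc unfolding E_E[of j j] by (simp add: kd_neq)
  have "E j j ?q = - ?q"
    by (simp add: step E E_lin)
  moreover have "?q \<in> Pol S" using p by (simp add: E_Pol)
  ultimately have "- lookup ?q \<mu> = of_int (wt (\<lambda>b. of_bool (b = j)) \<mu>) * lookup ?q \<mu>" for \<mu>
    using E_diagonal[of ?q S j \<mu>] by (metis lookup_uminus)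
  then have "(of_int (wt (\<lambda>b. of_bool (b = j)) \<mu> + 1) :: complex) * lookup ?q \<mu> = 0" for \<mu>
    by (simp add: distrib_right flip: eq_neg_iff_add_eq_0)
  moreover have "wt (\<lambda>b. of_bool (b = j)) \<mu> + 1 \<noteq> 0" for \<mu>
    using wt_nonneg[of "\<lambda>b. of_bool (b = j)" \<mu>] by simp
  ultimately have "lookup ?q \<mu> = 0" for \<mu>
    by (metis mult_eq_0_iff of_int_eq_0_iff)
  then show ?thesis by (intro poly_mapping_eqI) simp
qed

text \<open>E c j and E j c generate an sl2, for which p has weight 0; since the degree in the
  letter j bounds the number of raising steps, this is finite dimensional representation
  theory.\<close>

lemma E_raise_eq_0:
  assumes p: "p \<in> Pol S" "c \<in> S" and jc: "j \<noteq> c"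
    and w: "E j j p = 2 * p" "E c c p = 2 * p" and low: "E j c p = 0"
  shows "E c j p = 0"
proof -
  have jj: "E j j (E c j q) = E c j (E j j q) - E c j q" for q
    using jc unfolding E_E[of j j] by (simp add: kd_neq)
  have cc: "E c c (E c j q) = E c j (E c c q) + E c j q" for q
    using jc unfolding E_E[of c c] by (simp add: kd_neq)
  have fe: "E j c (E c j q) = E c j (E j c q) + E j j q - E c c q" for q
    unfolding E_E[of j c] by simp
  have 1: "E j c (E c j p) = 0"
    by (simp add: fe low w E_lin)
  \<comment> \<open>On the m-th raised vector \<open>E j j - E c c\<close> has eigenvalue -2m.
    Adding these for m < k gives the factor -k(k-1), that is -2 and -6 for k = 2 and 3.\<close>
  have 2: "E j c (E c j (E c j p)) = - 2 * E c j p"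
    by (subst fe) (simp add: 1 jj cc w E_lin)
  have 3: "E j c (E c j (E c j (E c j p))) = - 6 * E c j (E c j p)"
    by (subst fe) (simp add: 2 jj cc w E_lin)
  have "E c j (E c j p) = 0"
    using 3 unfolding E_E_E_eq_0[OF p jc w(1)] by (simp add: E_lin)
  with 2 show ?thesis by (simp add: E_lin)
qed

text \<open>The determinant of the symmetric matrix (X (c i) (c j)) with i, j < n, expanded along
  its last row and column.\<close>

primrec sdet :: "(nat \<Rightarrow> letter) \<Rightarrow> nat \<Rightarrow> pol" where
  "sdet c 0 = 1"
| "sdet c (Suc n) = X (c n) (c n) * sdet c n
    - cst (1 / 2) * (\<Sum>k<n. X (c n) (c k) * E (c n) (c k) (sdet c n))"

lemma lookup_X_empty: "lookup (X a b * p) {#} = 0"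
  by (simp add: X_def lookup_var_times)

lemma X_times_eq_0_iff: "X a b * p = 0 \<longleftrightarrow> p = 0"
proof
  assume "X a b * p = 0"
  then have "lookup (var (nrm a b) * p) (add_mset (nrm a b) \<mu>) = 0" for \<mu>
    by (simp add: X_def)
  then show "p = 0" by (intro poly_mapping_eqI) (simp add: lookup_var_times)
qed simp

lemma half_times_two: "cst (1 / 2) * (2 * p) = (p :: pol)" "2 * (cst (1 / 2) * p) = (p :: pol)"
  by (intro poly_mapping_eqI; simp)+

lemma sdet_Pol: "sdet c n \<in> Pol (c ` {..<n})"
proof (induction n)
  case (Suc n)
  let ?S = "c ` {..<Suc n}"
  have "c ` {..<n} \<subseteq> ?S" by auto
  then have "sdet c n \<in> Pol ?S"
    using Suc Pol_mono by blast
  then show ?case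
    by (auto intro!: psub_diff[OF psub_Pol] psub_cst[OF psub_Pol] psub_sum[OF psub_Pol] X_Pol E_Pol
        simp del: lessThan_Suc)
qed (simp add: one_Pol)

context
  fixes c :: "nat \<Rightarrow> letter"
  assumes c: "inj c"
begin

lemma fresh: "c n \<notin> c ` {..<n}"
  using c by (auto dest: injD)

lemma kd_c: "i \<noteq> j \<Longrightarrow> kd (c i) (c j) = 0"
  using c by (auto simp: kd_def dest: injD)

lemma sum_kd_c:
  assumes "i < n"
  shows "(\<Sum>k<n. kd (c i) (c k) * g k) = g i"
proof -
  have "(\<Sum>k<n. kd (c i) (c k) * g k) = (\<Sum>k<n. if i = k then g k else 0)"
    by (intro sum.cong) (auto simp: kd_c)
  also have "\<dots> = g i" using assms by simp
  finally show ?thesis .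
qed

lemma sdet_fresh: "E a (c n) (sdet c n) = 0" "D r a (c n) (sdet c n) = 0" "D r (c n) a (sdet c n) = 0"
  using E_eq_0[OF sdet_Pol fresh] D_eq_0[OF sdet_Pol fresh] D_commute by metis+

text \<open>Under the operators on the old letters the \<open>X (c n) (c k)\<close> transform like a
  vector and the \<open>E (c n) (c k)\<close> like a covector in \<open>k\<close>, so their
  contraction is invariant.\<close>

lemma E_sum_sdet:
  assumes "i < n" "j < n"
  shows "E (c i) (c j) (\<Sum>k<n. X (c n) (c k) * E (c n) (c k) (sdet c n))
    = (\<Sum>k<n. X (c n) (c k) * E (c n) (c k) (E (c i) (c j) (sdet c n)))"
proof -
  have "E (c i) (c j) (X (c n) (c k) * E (c n) (c k) (sdet c n))
      = X (c n) (c k) * E (c n) (c k) (E (c i) (c j) (sdet c n))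
        + kd (c j) (c k) * (X (c i) (c n) * E (c n) (c k) (sdet c n))
        - kd (c i) (c k) * (X (c n) (c k) * E (c n) (c j) (sdet c n))" for k
    unfolding E_X E_E[of "c i"] using assms by (simp add: kd_c algebra_simps kd_commute[of _ "c j"])
  then show ?thesis
    unfolding lin_sum[OF lin_E] using assms
    by (simp add: sum.distrib sum_subtractf sum_kd_c X_commute)
qed

text \<open>A determinant is a relative invariant of the general linear group: off-diagonal
  generators kill it, and each diagonal one acts by 2 since every letter labels a row and a column.
  Among the operators that involve the new letter, replacing it by an old one is computed directly;
  the opposite direction then follows from \<open>E_raise_eq_0\<close>.\<close>

lemma E_sdet:
  "(\<forall>i<n. \<forall>j<n. i \<noteq> j \<longrightarrow> E (c i) (c j) (sdet c n) = 0) \<and> (\<forall>i<n. E (c i) (c i) (sdet c n) = 2 * sdet c n)"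
proof (induction n)
  case (Suc n)
  let ?u = "sdet c n" and ?v = "sdet c (Suc n)" and ?N = "c n"
  let ?w = "\<Sum>k<n. X ?N (c k) * E ?N (c k) ?u"
  have old0: "E (c i) (c j) ?v = 0" if "i < n" "j < n" "i \<noteq> j" for i j
    using that Suc by (simp add: E_lin E_X E_sum_sdet kd_c)
  have old2: "E (c i) (c i) ?v = 2 * ?v" if "i < n" for i
  proof -
    have "E (c i) (c i) ?w = 2 * ?w"
      using that Suc by (simp add: E_lin E_sum_sdet sum_distrib_left mult.left_commute)
    then show ?thesis
      using that Suc by (simp add: E_lin E_X kd_c right_diff_distrib mult.left_commute)
  qed
  have new2: "E ?N ?N ?v = 2 * ?v"
  proof -
    have "E ?N ?N (X ?N (c k) * E ?N (c k) ?u) = 2 * (X ?N (c k) * E ?N (c k) ?u)" if "k < n" for k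
      unfolding E_X E_E[of ?N ?N] using that by (simp add: kd_c sdet_fresh E_lin algebra_simps)
    then have "E ?N ?N ?w = 2 * ?w" by (simp add: lin_sum[OF lin_E] sum_distrib_left)
    then show ?thesis by (simp add: E_lin E_X sdet_fresh right_diff_distrib mult.left_commute)
  qed
  have low: "E (c j) ?N ?v = 0" if j: "j < n" for j
  proof -
    have "E (c j) ?N (X ?N (c k) * E ?N (c k) ?u)
        = X ?N (c k) * E (c j) (c k) ?u + X (c j) (c k) * E ?N (c k) ?u" if "k < n" for k
      unfolding E_X E_E[of "c j"] using that j by (simp add: kd_c sdet_fresh E_lin)
    then have "E (c j) ?N ?w = (\<Sum>k<n. X ?N (c k) * E (c j) (c k) ?u)
        + (\<Sum>k<n. X (c j) (c k) * E ?N (c k) ?u)"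
      by (simp add: lin_sum[OF lin_E] sum.distrib)
    \<comment> \<open>Exchanging \<open>c j\<close> and the new letter turns the operator into one
      on the old letters, for which the induction hypothesis leaves only
      \<open>k = j\<close>.\<close>
    also have "(\<Sum>k<n. X (c j) (c k) * E ?N (c k) ?u) = (\<Sum>k<n. X ?N (c k) * E (c j) (c k) ?u)"
      using sum_X_E_commute[OF _ sdet_Pol, of c n "c j" ?N] c
      by (simp add: sum.reindex inj_on_subset)
    also have "(\<Sum>k<n. X ?N (c k) * E (c j) (c k) ?u) = (\<Sum>k<n. kd (c j) (c k) * (X ?N (c k) * (2 * ?u)))"
    proof (intro sum.cong refl)
      fix k assume "k \<in> {..<n}"
      then show "X ?N (c k) * E (c j) (c k) ?u = kd (c j) (c k) * (X ?N (c k) * (2 * ?u))"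
        using Suc j by (cases "j = k") (simp_all add: kd_c)
    qed
    also have "\<dots> = X ?N (c j) * (2 * ?u)" by (rule sum_kd_c[OF j])
    finally have w: "E (c j) ?N ?w = 2 * (2 * (X ?N (c j) * ?u))" by simp
    have "E (c j) ?N (X ?N ?N * ?u) = 2 * (X ?N (c j) * ?u)"
      by (simp add: E_X sdet_fresh X_commute mult.assoc)
    then show ?thesis
      by (simp only: sdet.simps E_lin w half_times_two) simp
  qed
  have high: "E ?N (c j) ?v = 0" if "j < n" for j
  proof (rule E_raise_eq_0[OF sdet_Pol])
    show "?N \<in> c ` {..<Suc n}" by simp
    show "c j \<noteq> ?N" using that injD[OF c, of j n] by auto
  qed (fact old2[OF that] new2 low[OF that])+
  show ?case
    using old0 old2 new2 low high by (auto simp: less_Suc_eq simp del: sdet.simps)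
qed simp

text \<open>The diagonal term contributes 2r; each of the n summands contributes 4, halved by the
  coefficient in \<open>sdet\<close>. Hence the zero at r = n.\<close>

lemma D_sdet: "D r (c n) (c n) (sdet c (Suc n)) = cst (2 * (r - of_nat n)) * sdet c n"
proof -
  let ?u = "sdet c n" and ?N = "c n"
  have "D r ?N ?N (X ?N (c k) * E ?N (c k) ?u) = 4 * ?u" if "k < n" for k
  proof -
    have "D r ?N ?N (E ?N (c k) ?u) = 0"
      unfolding D_E sdet_fresh by (simp add: E_lin)
    moreover have "E (c k) ?N (E ?N (c k) ?u) = 2 * ?u"
      unfolding E_E[of "c k"] sdet_fresh using that E_sdet[of n] by (simp add: E_lin kd_c)
    ultimately show ?thesis
      using that by (simp add: D_X D_comm_def kd_c)
  qed
  then have "D r ?N ?N (\<Sum>k<n. X ?N (c k) * E ?N (c k) ?u) = of_nat n * (4 * ?u)"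
    by (simp add: lin_sum[OF lin_D])
  moreover have "D r ?N ?N (X ?N ?N * ?u) = cst (2 * r) * ?u"
    by (intro poly_mapping_eqI) (simp add: D_X D_comm_def sdet_fresh lookup_add)
  ultimately show ?thesis
    by (intro poly_mapping_eqI)
      (simp add: D_lin lookup_minus left_diff_distrib right_diff_distrib)
qed

lemma D_sdet_eq_0: "D (of_nat n) a b (sdet c (Suc n)) = 0"
proof (rule D_eq_0_all[OF sdet_Pol])
  show "D (of_nat n) (c n) (c n) (sdet c (Suc n)) = 0" unfolding D_sdet by simp
  show "E (c n) a (sdet c (Suc n)) = 0" if "a \<in> c ` {..<Suc n}" "a \<noteq> c n" for a
    using that E_sdet[of "Suc n"] by (auto simp del: sdet.simps)
qed simp

lemma sdet_neq_0: "sdet c n \<noteq> 0"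
proof (induction n)
  case (Suc n)
  show ?case
  proof
    assume "sdet c (Suc n) = 0"
    \<comment> \<open>The determinant does not depend on the level, so nonvanishing may be tested at
      level n + 1, where the scalar is 2.\<close>
    then have "cst (2 * ((of_nat n + 1) - of_nat n)) * sdet c n = 0"
      using D_sdet[of "of_nat n + 1" n] by (simp only: D_lin)
    with Suc show False by simp
  qed
qed simp

end

section \<open>Powers of determinants of size one and two, for negative integral level\<close>

lemma D_X_power: "D r a a (X a a ^ Suc j) = cst (2 * of_nat (Suc j) * (2 * of_nat j + r)) * X a a ^ j"
proof (induction j)
  case (Suc j)
  have E: "E a a (X a a ^ m) = cst (2 * of_nat m) * X a a ^ m" for m
  proof (induction m)
    case (Suc m)
    have "E a a (X a a ^ Suc m) = X a a * E a a (X a a ^ m) + 2 * (X a a * X a a ^ m)"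
      by (simp add: E_X algebra_simps)
    then show ?case unfolding Suc
      by (simp add: algebra_simps single_add cst_mult)
  qed simp
  have "D r a a (X a a ^ Suc (Suc j)) = X a a * D r a a (X a a ^ Suc j) + D_comm r a a a a (X a a ^ Suc j)"
    by (subst power_Suc) (simp only: D_X)
  also have "D_comm r a a a a (X a a ^ Suc j) = cst (8 * of_nat (Suc j) + 2 * r) * X a a ^ Suc j"
    unfolding D_comm_def E by (simp add: cst_mult single_add algebra_simps del: power_Suc)
  also have "X a a * D r a a (X a a ^ Suc j)
      = cst (2 * of_nat (Suc j) * (2 * of_nat j + r)) * X a a ^ Suc j"
    unfolding Suc by (simp add: algebra_simps)
  also have "\<dots> + cst (8 * of_nat (Suc j) + 2 * r) * X a a ^ Suc j
      = cst (2 * of_nat (Suc (Suc j)) * (2 * of_nat (Suc j) + r)) * X a a ^ Suc j"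
    by (simp only: distrib_right[symmetric] single_add[symmetric]) (simp add: algebra_simps)
  finally show ?case .
qed (simp add: D_X[of r a a a a 1, simplified] D_comm_def cst_mult)

definition minor :: "letter \<Rightarrow> letter \<Rightarrow> pol" where
  "minor a b = X a a * X b b - X a b * X a b"

lemma E_power: "E a b p = 0 \<Longrightarrow> E a b (p ^ m) = 0"
  by (induction m) (simp_all add: E_mult)

context
  fixes a b :: letter
  assumes ab: "a \<noteq> b"
begin

lemma kd_ab [simp]: "kd a b = 0" "kd b a = 0"
  using ab by (simp_all add: kd_neq)

lemma E_X_single: "E p q (X s t) = kd s q * X p t + kd t q * X p s"
  using E_X[of p q s t 1] by simp

lemma E_minor: "E a b (minor a b) = 0" "E b a (minor a b) = 0" "E a a (minor a b) = 2 * minor a b"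
  unfolding minor_def by (simp_all add: E_lin E_mult E_X_single algebra_simps X_commute)

text \<open>The assumption, satisfied by powers of the minor, removes the terms in which
  \<open>b\<close> replaces \<open>a\<close> inside \<open>q\<close>. The rest of the commutator is
  a multiple of \<open>X b b\<close>.\<close>

lemma D_minor_times:
  assumes q: "E b a q = 0"
  shows "D r a a (minor a b * q) = minor a b * D r a a q + X b b * (4 * E a a q + cst (2 * r - 2) * q)"
proof -
  have "E b a (X a b * q) = X b b * q"
    using q by (simp add: E_X)
  moreover have "D r a a (X a b * q) = X a b * D r a a q + 2 * E b a q"
    by (simp add: D_X D_comm_def)
  ultimately have 2: "D r a a (X a b * (X a b * q)) = X a b * (X a b * D r a a q) + 2 * (X b b * q)"
    using q by (subst D_X) (simp add: D_comm_def)
  have bb: "D r a a (X b b * q) = X b b * D r a a q" "E a a (X b b * q) = X b b * E a a q"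
    by (simp_all add: D_X E_X D_comm_def)
  have 1: "D r a a (X a a * (X b b * q)) = X a a * (X b b * D r a a q) + X b b * (4 * E a a q + cst (2 * r) * q)"
    unfolding D_X[of r a a a a] bb D_comm_def
    by (simp add: bb algebra_simps cst_mult)
  have 3: "minor a b * q = X a a * (X b b * q) - X a b * (X a b * q)"
    by (simp add: minor_def algebra_simps)
  show ?thesis
    unfolding 3 D_lin 1 2 by (simp add:  minor_def algebra_simps single_diff cst_mult)
qed

text \<open>The increments 8i + 2r - 2 for i from 0 to j add up to the stated constant, which
  vanishes at r = 1 - 2j.\<close>

lemma D_minor_power:
  "D r a a (minor a b ^ Suc j) = cst (2 * of_nat (Suc j) * (2 * of_nat j + r - 1)) * (X b b * minor a b ^ j)"
proof -
  have E: "E a a (minor a b ^ m) = cst (2 * of_nat m) * minor a b ^ m" for m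
  proof (induction m)
    case (Suc m)
    then show ?case
      by (simp add: E_mult E_minor algebra_simps single_add cst_mult)
  qed simp
  have step: "D r a a (minor a b ^ Suc j) = minor a b * D r a a (minor a b ^ j)
      + cst (8 * of_nat j + 2 * r - 2) * (X b b * minor a b ^ j)" for j
    unfolding power_Suc D_minor_times[OF E_power[OF E_minor(2)]] E
    by (simp add: algebra_simps single_add single_diff cst_mult)
  show ?thesis
  proof (induction j)
    case 0
    show ?case unfolding step by simp
  next
    case (Suc j)
    have "minor a b * D r a a (minor a b ^ Suc j)
        = cst (2 * of_nat (Suc j) * (2 * of_nat j + r - 1)) * (X b b * minor a b ^ Suc j)"
      unfolding Suc by (simp add: algebra_simps)
    then show ?case
      unfolding step[of "Suc j"]
      by (simp only: distrib_right[symmetric] single_add[symmetric]) (simp add: cst_mult single_add single_diff algebra_simps)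
  qed
qed

lemma minor_power_neq_0: "minor a b ^ m \<noteq> 0"
proof (induction m)
  case (Suc m)
  show ?case
  proof
    assume "minor a b ^ Suc m = 0"
    \<comment> \<open>The level is again free; at level 2 the constant is a positive integer for
      every m.\<close>
    then have "cst (2 * of_nat (Suc m) * (2 * of_nat m + 2 - 1)) * (X b b * minor a b ^ m) = 0"
      using D_minor_power[of 2 m] by (simp only: D_lin)
    moreover have "(2 * of_nat (Suc m) * (2 * of_nat m + 2 - 1) :: complex) = of_nat (2 * Suc m * (2 * m + 1))"
      by (simp add: algebra_simps)
    then have "(2 * of_nat (Suc m) * (2 * of_nat m + 2 - 1) :: complex) \<noteq> 0"
      by (simp only: of_nat_eq_0_iff) simp
    ultimately have "X b b * minor a b ^ m = 0" by (metis cst_times_eq_0_iff)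
    with Suc show False by (simp add: X_times_eq_0_iff)
  qed
qed simp

lemma minor_power_Pol: "minor a b ^ m \<in> Pol {a, b}"
proof (induction m)
  case (Suc m)
  then show ?case
    by (simp add: minor_def left_diff_distrib mult.assoc psub_diff[OF psub_Pol] X_Pol)
qed (simp add: one_Pol)

end

text \<open>Each family is taken where its scalar vanishes: size n + 1 at r = n, the power j + 1 of
  one variable at r = -2j, and the power j + 1 of a minor at r = 1 - 2j. By
  \<open>D_eq_0_all\<close> only one second order operator needs this computation.\<close>

lemma singular_vector_exists:
  fixes c :: "nat \<Rightarrow> letter"
  assumes r: "r \<in> \<int>" and c: "inj c" "range c \<subseteq> S"
  obtains s where "s \<in> Pol S" "s \<noteq> 0" "lookup s {#} = 0" "\<And>a b. D r a b s = 0"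
proof -
  obtain k :: int where k: "r = of_int k" using r by (auto elim: Ints_cases)
  have c01: "c 0 \<noteq> c 1" "c 0 \<in> S" "c 1 \<in> S" using c by (auto dest: injD)
  consider n where "k = int n" | j where "k = - 2 * int j" | j where "k = 1 - 2 * int j"
  proof (cases "k \<ge> 0")
    case False
    show ?thesis
    proof (cases "even k")
      case True
      then obtain l where "k = 2 * l" by (rule evenE)
      with False that(2)[of "nat (- l)"] show ?thesis by simp
    next
      case odd: False
      then obtain l where "k = 2 * l + 1" by (rule oddE)
      with False that(3)[of "nat (- l)"] show ?thesis by simp
    qed
  qed (use that(1)[of "nat k"] in simp)
  then show thesis
  proof cases
    case 1
    show thesis
    proof (rule that)
      show "sdet c (Suc n) \<in> Pol S"
        using sdet_Pol[of c "Suc n"] Pol_mono[of "c ` {..<Suc n}" S] c by blast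
      show "sdet c (Suc n) \<noteq> 0" by (rule sdet_neq_0[OF c(1)])
      show "lookup (sdet c (Suc n)) {#} = 0"
        by (simp add: lookup_minus lookup_sum lookup_X_empty)
      show "D r a b (sdet c (Suc n)) = 0" for a b
        using D_sdet_eq_0[OF c(1), of n] 1 k by simp
    qed
  next
    case 2
    let ?s = "X (c 0) (c 0) ^ Suc j"
    have Pol: "X (c 0) (c 0) ^ m \<in> Pol {c 0}" for m
      by (induction m) (simp_all add: one_Pol X_Pol)
    have neq: "X (c 0) (c 0) ^ m \<noteq> 0" for m
      by (induction m) (simp_all add: X_times_eq_0_iff)
    show thesis
    proof (rule that)
      show "?s \<in> Pol S" using Pol Pol_mono[of "{c 0}" S] c01 by blast
      show "?s \<noteq> 0" by (rule neq)
      show "lookup ?s {#} = 0" by (simp add: lookup_X_empty)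
      show "D r a b ?s = 0" for a b
      proof (rule D_eq_0_all[OF Pol])
        show "D r (c 0) (c 0) ?s = 0"
          unfolding D_X_power using 2 k by simp
      qed auto
    qed
  next
    case 3
    let ?s = "minor (c 0) (c 1) ^ Suc j"
    show thesis
    proof (rule that)
      show "?s \<in> Pol S" using minor_power_Pol[OF c01(1), of "Suc j"] Pol_mono[of "{c 0, c 1}" S] c01 by blast
      show "?s \<noteq> 0" by (rule minor_power_neq_0[OF c01(1)])
      show "lookup ?s {#} = 0"
        by (simp add: minor_def left_diff_distrib mult.assoc lookup_minus lookup_X_empty)
      show "D r a b ?s = 0" for a b
      proof (rule D_eq_0_all[OF minor_power_Pol[OF c01(1)]])
        show "D r (c 0) (c 0) ?s = 0"
          unfolding D_minor_power[OF c01(1)] using 3 k by simp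
        show "E (c 0) a ?s = 0" if "a \<in> {c 0, c 1}" "a \<noteq> c 0" for a
          using that E_power[OF E_minor(1)[OF c01(1)]] by blast
      qed simp
    qed
  qed
qed

section \<open>The radical and its stability\<close>

definition D_word :: "complex \<Rightarrow> (letter \<times> letter) list \<Rightarrow> pol \<Rightarrow> pol" where
  "D_word r ws p = foldr (\<lambda>(a, b). D r a b) ws p"

lemma D_word_simps [simp]: "D_word r [] p = p" "D_word r (ws @ [(a, b)]) p = D_word r ws (D r a b p)"
  by (simp_all add: D_word_def)

lemma lin_D_word: "lin (D_word r ws)"
  by (rule linI; induction ws rule: rev_induct) (auto simp: D_lin)

text \<open>This is the radical of the contravariant form for which \<open>X a b\<close> and
  \<open>D r a b\<close> are adjoint: a word in the \<open>D\<close> followed by the constant term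
  is the pairing with the corresponding monomial.\<close>

definition Rad :: "complex \<Rightarrow> letter set \<Rightarrow> pol set" where
  "Rad r S = {p \<in> Pol S. \<forall>ws. set ws \<subseteq> S \<times> S \<longrightarrow> lookup (D_word r ws p) {#} = 0}"

lemma psub_Rad: "psub (Rad r S)"
  using psub_Pol[of S]
  by (auto simp: psub_def Rad_def lin_add[OF lin_D_word] lin_cst[OF lin_D_word] lin_zero[OF lin_D_word] lookup_add)

lemma Rad_word: "p \<in> Rad r S \<Longrightarrow> set ws \<subseteq> S \<times> S \<Longrightarrow> lookup (D_word r ws p) {#} = 0"
  by (simp add: Rad_def)

lemma D_Rad:
  assumes "p \<in> Rad r S" "a \<in> S" "b \<in> S"
  shows "D r a b p \<in> Rad r S"
  using assms Rad_word[OF assms(1), of "_ @ [(a, b)]"] by (auto simp: Rad_def D_Pol)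

text \<open>The operator \<open>E\<close> is moved to the left through the word. Commutators give
  shorter words in the \<open>D\<close>, and at the far left \<open>E\<close> has no constant
  term.\<close>

lemma E_Rad:
  assumes "p \<in> Rad r S" "a \<in> S" "b \<in> S"
  shows "E a b p \<in> Rad r S"
proof -
  have "lookup (D_word r ws (E a b p)) {#} = 0" if "set ws \<subseteq> S \<times> S" for ws
    using that assms(1)
  \<comment> \<open>The last pair of a word acts first, so induction from the right peels off the
    operator next to the vector, which stays in the radical.\<close>
  proof (induction ws arbitrary: p rule: rev_induct)
    case (snoc w ws)
    obtain c d where w: "w = (c, d)" by (cases w)
    with snoc.prems have cd: "c \<in> S" "d \<in> S" and ws: "set ws \<subseteq> S \<times> S" by auto
    have "lookup (D_word r ws (E a b (D r c d p))) {#} = 0"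
      using snoc cd ws by (intro snoc.IH D_Rad)
    moreover have "kd c a * D r d b p + kd d a * D r c b p \<in> Rad r S"
      using snoc cd assms by (intro psub_add[OF psub_Rad] psub_kd[OF psub_Rad] D_Rad)
    ultimately show ?case
      unfolding w by (simp add: D_E add.assoc lin_add[OF lin_D_word, of r ws "E a b (D r c d p)"] lookup_add Rad_word ws)
  qed (simp add: lookup_E_empty)
  then show ?thesis using assms by (simp add: Rad_def E_Pol)
qed

text \<open>As for \<open>E_Rad\<close>, but passing a \<open>D\<close> leaves \<open>E\<close>
  terms and scalars, which is why stability under \<open>E\<close> comes first.\<close>

lemma X_Rad:
  assumes "p \<in> Rad r S" "a \<in> S" "b \<in> S"
  shows "X a b * p \<in> Rad r S"
proof -
  have "lookup (D_word r ws (X a b * p)) {#} = 0" if "set ws \<subseteq> S \<times> S" for ws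
    using that assms(1)
  proof (induction ws arbitrary: p rule: rev_induct)
    case (snoc w ws)
    obtain c d where w: "w = (c, d)" by (cases w)
    with snoc.prems have cd: "c \<in> S" "d \<in> S" and ws: "set ws \<subseteq> S \<times> S" by auto
    have "lookup (D_word r ws (X a b * D r c d p)) {#} = 0"
      using snoc cd ws by (intro snoc.IH D_Rad)
    moreover have "D_comm r c d a b p \<in> Rad r S"
      unfolding D_comm_def using snoc cd assms
      by (intro psub_add[OF psub_Rad] psub_cst[OF psub_Rad] psub_kd[OF psub_Rad] E_Rad)
    ultimately show ?case
      unfolding w by (simp add: D_X lin_add[OF lin_D_word] lookup_add Rad_word ws)
  qed (simp add: lookup_X_empty)
  then show ?thesis using assms by (simp add: Rad_def X_Pol)
qed

lemma singular_Rad: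
  assumes "s \<in> Pol S" "lookup s {#} = 0" "\<And>a b. D r a b s = 0"
  shows "s \<in> Rad r S"
proof -
  have "lookup (D_word r ws s) {#} = 0" for ws
    by (cases ws rule: rev_cases) (auto simp: assms lin_zero[OF lin_D_word])
  then show ?thesis using assms by (simp add: Rad_def)
qed

lemma one_notin_Rad: "1 \<notin> Rad r S"
  using Rad_word[of 1 r S "[]"] by (auto simp: lookup_one)

section \<open>The action on \<open>M\<^sub>r\<close> in the polynomial model\<close>

text \<open>The operator v^{ij}(m,n), where the constant 1 occurring in its expansion over the
  basis acts by the scalar s: this is 1 in M_r, but r in the brackets [x,y]_r.\<close>

definition V :: "complex \<Rightarrow> complex \<Rightarrow> nat \<Rightarrow> nat \<Rightarrow> int \<Rightarrow> int \<Rightarrow> pol \<Rightarrow> pol" where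
  "V r s i j m n p =
    (if m < 0 \<and> n < 0 then X (i, m) (j, n) * p
     else if m < 0 \<and> n > 0 then cst (of_int n) * E (i, m) (j, - n) p
     else if m > 0 \<and> n < 0 then cst (of_int m) * E (j, n) (i, - m) p
       + (if i = j \<and> m = - n then cst (s * of_int m) * p else 0)
     else if m > 0 \<and> n > 0 then cst (of_int m * of_int n) * D r (i, - m) (j, - n) p
     else 0)"

lemma V_cases:
  fixes m n :: int
  obtains (neg_neg) "m < 0" "n < 0" | (neg_pos) "m < 0" "n > 0" | (pos_neg) "m > 0" "n < 0"
    | (pos_pos) "m > 0" "n > 0" | (zero) "m = 0 \<or> n = 0"
  by linarith

lemma V_simps:
  "m < 0 \<Longrightarrow> n < 0 \<Longrightarrow> V r s i j m n p = X (i, m) (j, n) * p"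
  "m < 0 \<Longrightarrow> n > 0 \<Longrightarrow> V r s i j m n p = cst (of_int n) * E (i, m) (j, - n) p"
  "m > 0 \<Longrightarrow> n < 0 \<Longrightarrow> V r s i j m n p = cst (of_int m) * E (j, n) (i, - m) p
    + (if i = j \<and> m = - n then cst (s * of_int m) * p else 0)"
  "m > 0 \<Longrightarrow> n > 0 \<Longrightarrow> V r s i j m n p = cst (of_int m * of_int n) * D r (i, - m) (j, - n) p"
  "m = 0 \<or> n = 0 \<Longrightarrow> V r s i j m n p = 0"
  by (auto simp: V_def)

lemma lin_if: "(P \<Longrightarrow> lin S) \<Longrightarrow> (\<not> P \<Longrightarrow> lin T) \<Longrightarrow> lin (\<lambda>p. if P then S p else T p)"
  by (cases P) simp_all

lemma lin_zero_fun: "lin (\<lambda>p. 0)"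
  by (simp add: lin_def)

lemma lin_V: "lin (V r s i j m n)"
  unfolding V_def by (intro lin_if lin_plus lin_times lin_E lin_D lin_mult lin_zero_fun)

definition Op :: "complex \<Rightarrow> idx \<Rightarrow> pol \<Rightarrow> pol" where
  "Op r b = (case b of (i, j, m, n) \<Rightarrow> V r 0 i j m n)"

lemma lin_Op: "lin (Op r b)"
  by (cases b) (simp add: Op_def lin_V)

definition Act :: "complex \<Rightarrow> complex \<Rightarrow> lel \<Rightarrow> pol \<Rightarrow> pol" where
  "Act r s x p = (\<Sum>c\<in>{c. x (Some c) \<noteq> 0}. cst (x (Some c)) * Op r c p) + cst (s * x None) * p"

definition finsupp :: "lel \<Rightarrow> bool" where
  "finsupp x \<longleftrightarrow> finite {c. x (Some c) \<noteq> 0}"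

lemma Act_eq_sum:
  assumes "finite B" "{c. x (Some c) \<noteq> 0} \<subseteq> B"
  shows "Act r s x p = (\<Sum>c\<in>B. cst (x (Some c)) * Op r c p) + cst (s * x None) * p"
  unfolding Act_def using assms by (intro arg_cong2[of _ _ _ _ "(+)"] sum.mono_neutral_left) auto

lemma finsupp_add: "finsupp x \<Longrightarrow> finsupp y \<Longrightarrow> finsupp (\<lambda>z. x z + y z)"
  unfolding finsupp_def by (rule finite_subset[of _ "{c. x (Some c) \<noteq> 0} \<union> {c. y (Some c) \<noteq> 0}"]) auto

lemma finsupp_if: "finsupp x \<Longrightarrow> finsupp (\<lambda>z. if P then k * x z else 0)"
  unfolding finsupp_def by (rule finite_subset[of _ "{c. x (Some c) \<noteq> 0}"]) auto

lemma finsupp_vnorm: "finsupp (vnorm i j m n)"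
  unfolding finsupp_def
  by (rule finite_subset[of _ "{(i,j,m,n), (j,i,n,m)}"]) (auto simp: vnorm_def bas_def lone_def split: if_splits)

lemma Act_add:
  assumes "finsupp x" "finsupp y"
  shows "Act r s (\<lambda>z. x z + y z) p = Act r s x p + Act r s y p"
proof -
  let ?B = "{c. x (Some c) \<noteq> 0} \<union> {c. y (Some c) \<noteq> 0}"
  have "finite ?B" "{c. x (Some c) + y (Some c) \<noteq> 0} \<subseteq> ?B"
    using assms by (auto simp: finsupp_def)
  then show ?thesis
    using Act_eq_sum[of ?B "\<lambda>z. x z + y z" r s p] Act_eq_sum[of ?B x r s p] Act_eq_sum[of ?B y r s p]
    by (simp add: single_add distrib_right distrib_left sum.distrib)
qed

lemma Act_if:
  assumes "finsupp x"
  shows "Act r s (\<lambda>z. if P then k * x z else 0) p = (if P then cst k * Act r s x p else 0)"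
proof -
  let ?B = "{c. x (Some c) \<noteq> 0}"
  have "finite ?B" using assms by (simp add: finsupp_def)
  then have "Act r s (\<lambda>z. k * x z) p = cst k * Act r s x p"
    using Act_eq_sum[of ?B "\<lambda>z. k * x z" r s p] Act_eq_sum[of ?B x r s p]
    by (auto simp: distrib_left sum_distrib_left cst_mult mult_ac)
  moreover have "Act r s (\<lambda>z. 0) p = 0" by (simp add: Act_def)
  ultimately show ?thesis by simp
qed

lemma Act_bas: "Act r s (bas b) p = Op r b p"
  using Act_eq_sum[of "{b}" "bas b" r s p] by (simp add: bas_def)

lemma V_commute:
  assumes "i \<noteq> j \<or> m \<noteq> - n"
  shows "V r s i j m n p = V r t j i n m p"
proof (cases rule: V_cases[of m n])
  case neg_neg
  then show ?thesis using X_commute by (simp add: V_simps)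
next
  case pos_pos
  then show ?thesis
    using D_commute by (simp add: V_simps mult.commute[of "of_int n"])
next
  case pos_neg
  then show ?thesis using assms by (auto simp: V_simps)
next
  case neg_pos
  then show ?thesis using assms by (auto simp: V_simps)
qed (auto simp: V_simps)

lemma V_scalar: "i \<noteq> j \<or> m \<noteq> - n \<or> m \<le> n \<Longrightarrow> V r s i j m n p = V r t i j m n p"
  by (cases rule: V_cases[of m n]) (simp_all only: V_simps, auto)

lemma Act_vnorm: "Act r s (vnorm i j m n) p = V r s i j m n p"
proof -
  consider "i < j" | "j < i" | "i = j" "m \<le> n" | "i = j" "n < m" "m = - n" | "i = j" "n < m" "m \<noteq> - n"
    by linarith
  then show ?thesis
  proof cases
    case 1
    then show ?thesis using V_scalar[of i j] by (simp add: vnorm_def Act_bas Op_def)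
  next
    case 2
    then show ?thesis using V_commute[of i j m n r s p 0] by (simp add: vnorm_def Act_bas Op_def)
  next
    case 3
    then show ?thesis using V_scalar[of i j m n] by (simp add: vnorm_def Act_bas Op_def)
  next
    case 4
    \<comment> \<open>The only reordering that produces a constant, hence the only place where the
      scalar \<open>s\<close> enters.\<close>
    have "Act r s (\<lambda>x. bas (i, i, n, m) x + of_int m * lone x) p
        = Op r (i, i, n, m) p + cst (s * of_int m) * p"
      using Act_eq_sum[of "{(i, i, n, m)}" "\<lambda>x. bas (i, i, n, m) x + of_int m * lone x" r s p]
      by (simp add: bas_def lone_def)
    with 4 show ?thesis by (simp add: vnorm_def Op_def V_simps)
  next
    case 5
    then show ?thesis using V_commute[of i j m n r s p 0] by (simp add: vnorm_def Act_bas Op_def)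
  qed
qed

lemma Act_brA:
  "Act r s (brA (i, j, m, n) (k, l, c, e)) p =
      (if j = k \<and> n + c = 0 then cst (of_int n) * V r s i l m e p else 0)
    + (if j = l \<and> n + e = 0 then cst (of_int n) * V r s i k m c p else 0)
    + (if i = k \<and> m + c = 0 then cst (of_int m) * V r s l j e n p else 0)
    + (if i = l \<and> m + e = 0 then cst (of_int m) * V r s k j c n p else 0)"
  unfolding brA_def prod.case
  by (simp only: Act_add Act_if finsupp_add finsupp_if finsupp_vnorm Act_vnorm)

lemma VS_UNIV: "(i, j, m, n) \<in> VS UNIV \<longleftrightarrow> i < j \<or> i = j \<and> m \<le> n"
proof
  assume "(i, j, m, n) \<in> VS UNIV"
  then obtain a b where "(i, j, m, n) = nrm a b" by (rule VS_E)
  then show "i < j \<or> i = j \<and> m \<le> n"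
    by (cases a; cases b) (auto simp: nrm.simps split: if_splits)
next
  assume "i < j \<or> i = j \<and> m \<le> n"
  then have "(i, j, m, n) = nrm (i, m) (j, n)" by (auto simp: nrm.simps min_def max_def)
  then show "(i, j, m, n) \<in> VS UNIV" by (metis nrm_VS UNIV_I)
qed

lemma nrm_eq: "(i, j, m, n) \<in> VS UNIV \<Longrightarrow> nrm (i, m) (j, n) = (i, j, m, n)"
  by (auto simp: VS_UNIV nrm.simps)

lemma vnorm_support: "vnorm i j m n (Some c) \<noteq> 0 \<Longrightarrow> c \<in> VS UNIV"
  by (auto simp: vnorm_def bas_def lone_def VS_UNIV split: if_splits)

lemma brA_support: "brA b y (Some c) \<noteq> 0 \<Longrightarrow> c \<in> VS UNIV"
proof (rule ccontr)
  assume "brA b y (Some c) \<noteq> 0" "c \<notin> VS UNIV"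
  moreover from this(2) have vn: "vnorm i j m n (Some c) = 0" for i j m n
    using vnorm_support by blast
  ultimately show False by (cases b; cases y) (simp add: brA_def vn cong: if_cong)
qed

lemma kd_times_if: "kd (k, c) (j, - n) * p = (if j = k \<and> n + c = 0 then p else 0)"
  by (auto simp: kd_def)

lemma Act_brA_kd:
  "Act r s (brA (i, j, m, n) (k, l, c, e)) p =
      kd (k, c) (j, - n) * (cst (of_int n) * V r s i l m e p)
    + kd (l, e) (j, - n) * (cst (of_int n) * V r s i k m c p)
    + kd (k, c) (i, - m) * (cst (of_int m) * V r s l j e n p)
    + kd (l, e) (i, - m) * (cst (of_int m) * V r s k j c n p)"
  unfolding Act_brA kd_times_if ..

lemma V_zero: "V r s i j 0 n p = 0" "V r s i j m 0 p = 0"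
  by (simp_all add: V_def)

lemma V_pos_neg:
  "m > 0 \<Longrightarrow> n < 0 \<Longrightarrow> V r s i j m n p = cst (of_int m) * E (j, n) (i, - m) p
    + kd (j, n) (i, - m) * (cst (s * of_int m) * p)"
  by (simp add: V_simps kd_times_if add.commute eq_neg_iff_add_eq_0 del: single_of_int)

lemma kd_eq_0: "c < 0 \<Longrightarrow> m < 0 \<Longrightarrow> kd (k, c) (i, - m) = 0"
  by (simp add: kd_def)

text \<open>This is the recursion defining \<open>Fr\<close>. In \<open>V\<close> a mode v^i(m) with
  m > 0 acts as m times the derivative by the letter (i,-m), matching the bracket. The second
  \<open>r\<close> of \<open>Act r r\<close> is the weight of the constant part in [x,y]_r.\<close>

lemma Op_var:
  assumes b: "b \<in> VS UNIV" and y: "isBm y" and nb: "\<not> isBm b"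
  shows "Op r b (var y * p) = Act r r (brA b y) p + var y * Op r b p"
proof -
  obtain i j m n where b': "b = (i, j, m, n)" by (cases b)
  obtain k l c e where y': "y = (k, l, c, e)" by (cases y)
  have ce: "c < 0" "e < 0" using y by (simp_all add: y' isBm_def)
  show ?thesis
  proof (cases rule: V_cases[of m n])
    case neg_neg
    with nb show ?thesis by (simp add: b' isBm_def)
  next
    case neg_pos
    note v = V_simps(1)[OF neg_pos(1) ce(1)] V_simps(1)[OF neg_pos(1) ce(2)]
      kd_eq_0[OF ce(1) neg_pos(1)] kd_eq_0[OF ce(2) neg_pos(1)]
    show ?thesis
      unfolding b' y' Op_def prod.case Act_brA_kd v V_simps(2)[OF neg_pos] E_var la.simps lb.simps
      by (simp add: algebra_simps)
  next
    case pos_neg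
    \<comment> \<open>A normalized index with equal colours has ordered modes, which excludes m > 0
      > n; so no scalar term arises.\<close>
    then have "i \<noteq> j" using b by (auto simp: b' VS_UNIV)
    then have op: "V r 0 i j m n = (\<lambda>p. cst (of_int m) * E (j, n) (i, - m) p)"
      using pos_neg by (simp add: V_simps fun_eq_iff)
    note v = V_simps(1)[OF ce(1) pos_neg(2)] V_simps(1)[OF ce(2) pos_neg(2)]
      kd_eq_0[OF ce(1) pos_neg(2)] kd_eq_0[OF ce(2) pos_neg(2)]
    show ?thesis
      unfolding b' y' Op_def prod.case Act_brA_kd v op E_var la.simps lb.simps
      by (simp add: algebra_simps X_commute)
  next
    case pos_pos
    \<comment> \<open>The bracket of two annihilation modes with two creation modes contains modes
      in the wrong order; their constants, weighted by \<open>r\<close>, become the scalar part of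
      \<open>D_comm\<close>.\<close>
    note v = V_pos_neg[OF pos_pos(1) ce(1)] V_pos_neg[OF pos_pos(1) ce(2)]
      V_simps(2)[OF ce(1) pos_pos(2)] V_simps(2)[OF ce(2) pos_pos(2)]
    show ?thesis
      unfolding b' y' Op_def prod.case Act_brA_kd v V_simps(4)[OF pos_pos] D_var la.simps lb.simps
        D_comm_def cst_mult
      by (simp add: algebra_simps)
  next
    case zero
    then show ?thesis
      by (elim disjE) (simp_all add: b' y' Op_def Act_brA_kd V_zero)
  qed
qed

text \<open>In particular \<open>Fr\<close> depends only on the multiset of factors, so the choice
  of an ordering in \<open>act_basis\<close> is harmless.\<close>

lemma Fr_eq_Op:
  assumes "\<forall>y\<in>set xs. isBm y" "b \<in> VS UNIV"
  shows "Fr r xs b = lookup (Op r b (mon (mset xs)))"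
  using assms
proof (induction xs arbitrary: b)
  case Nil
  obtain i j m n where b: "b = (i, j, m, n)" by (cases b)
  show ?case
  proof (cases "isBm b")
    case True
    then show ?thesis
      using nrm_eq[of i j m n] Nil by (auto simp: b isBm_def Op_def V_simps X_def var_def mono_def lookup_single when_def)
  next
    case False
    then show ?thesis
      by (auto simp: b isBm_def Op_def V_def fun_eq_iff)
  qed
next
  case (Cons y zs)
  show ?case
  proof (cases "isBm b")
    case True
    obtain i j m n where b: "b = (i, j, m, n)" by (cases b)
    have "Op r b p = var b * p" for p
      using True nrm_eq[of i j m n] Cons.prems by (simp add: b isBm_def Op_def V_simps X_def)
    then have "Op r b (mon (mset (y # zs))) = mon (add_mset b (mset (y # zs)))"
      by (simp only: mon_add_mset)
    with True show ?thesis by (auto simp: mono_def fun_eq_iff lookup_single)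
  next
    case False
    let ?q = "mon (mset zs)"
    have y: "isBm y" using Cons.prems by simp
    have IH: "Fr r zs c = lookup (Op r c ?q)" if "c \<in> VS UNIV" for c
      using Cons.IH Cons.prems that by simp
    have "lookup (Op r b (mon (mset (y # zs)))) \<mu> = (\<Sum>c\<in>{c. brR r b y (Some c) \<noteq> 0}. brR r b y (Some c) * Fr r zs c \<mu>)
        + brR r b y None * mono (mset zs) \<mu> + mulB y (Fr r zs b) \<mu>" for \<mu>
    proof -
      have "Op r b (mon (mset (y # zs))) = Act r r (brA b y) ?q + var y * Op r b ?q"
        unfolding mset.simps mon_add_mset using Op_var[OF Cons.prems(2) y False] .
      moreover have "lookup (Act r r (brA b y) ?q) \<mu>
          = (\<Sum>c\<in>{c. brA b y (Some c) \<noteq> 0}. brA b y (Some c) * Fr r zs c \<mu>) + r * brA b y None * lookup ?q \<mu>"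
        unfolding Act_def lookup_add lookup_sum lookup_cst_times
        by (intro arg_cong2[of _ _ _ _ "(+)"] sum.cong) (auto simp: IH dest: brA_support)
      ultimately show ?thesis
        by (auto simp: lookup_add brR_def mono_def lookup_single mulB_def lookup_var_times IH[OF Cons.prems(2)])
    qed
    then show ?thesis using False by (simp add: fun_eq_iff)
  qed
qed

definition negative :: "letter set" where
  "negative = {a. snd a < 0}"

lemma isBm_VS: "y \<in> VS S \<Longrightarrow> S \<subseteq> negative \<Longrightarrow> isBm y"
proof (elim VS_E)
  fix a b assume "S \<subseteq> negative" "y = nrm a b" "a \<in> S" "b \<in> S"
  then show "isBm y"
    by (cases a; cases b) (auto simp: negative_def isBm_def nrm.simps min_def max_def)
qed

lemma act_basis_eq:
  assumes p: "p \<in> Pol S" and S: "S \<subseteq> negative" and b: "b \<in> VS UNIV"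
  shows "act_basis r b (lookup p) = lookup (Op r b p)"
proof -
  have "Fr r (SOME xs. mset xs = \<mu>) b = lookup (Op r b (mon \<mu>))" if \<mu>: "\<mu> \<in> keys p" for \<mu>
  proof -
    have m: "mset (SOME xs. mset xs = \<mu>) = \<mu>" by (rule someI_ex) (rule ex_mset)
    have "isBm y" if "y \<in># \<mu>" for y
      using p \<mu> that isBm_VS[OF _ S] unfolding Pol_def by blast
    then have "\<forall>y\<in>set (SOME xs. mset xs = \<mu>). isBm y"
      by (metis m set_mset_mset)
    from Fr_eq_Op[OF this b] show ?thesis by (simp only: m)
  qed
  then have "act_basis r b (lookup p) \<nu> = lookup (\<Sum>\<mu>\<in>keys p. cst (lookup p \<mu>) * Op r b (mon \<mu>)) \<nu>" for \<nu>
    unfolding act_basis_def lookup_sum lookup_cst_times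
    by (intro sum.cong) (auto simp: in_keys_iff)
  moreover have "(\<Sum>\<mu>\<in>keys p. cst (lookup p \<mu>) * Op r b (mon \<mu>)) = Op r b p"
    by (subst (2) pol_eq_sum) (simp only: lin_sum[OF lin_Op] lin_cst[OF lin_Op])
  ultimately show ?thesis by (simp add: fun_eq_iff)
qed

lemma act_vnorm_eq:
  assumes p: "p \<in> Pol S" and S: "S \<subseteq> negative"
  shows "act r (vnorm i j m n) (lookup p) = lookup (V r 1 i j m n p)"
proof -
  have "act r (vnorm i j m n) (lookup p) \<nu> = lookup (Act r 1 (vnorm i j m n) p) \<nu>" for \<nu>
    unfolding act_def Act_def lookup_add lookup_sum lookup_cst_times
    using vnorm_support by (auto simp: act_basis_eq[OF p S] intro!: sum.cong)
  then show ?thesis by (simp add: Act_vnorm fun_eq_iff)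
qed

text \<open>The mode v^{ii}(0,0) acts by zero and is left out. The scalar may be set to 0: for
  \<open>i = j\<close> and \<open>m = 0\<close> only ordered modes occur, and otherwise no term is
  of the form v^{ii}(h,-h).\<close>

definition LL :: "complex \<Rightarrow> nat \<Rightarrow> nat \<Rightarrow> int \<Rightarrow> pol \<Rightarrow> pol" where
  "LL r i j m p =
    (if i = j \<and> m = 0 then Sum_any (\<lambda>h. if h > 0 then V r 0 i i (- h) h p else 0)
     else cst (1 / 2) * Sum_any (\<lambda>h. V r 0 i j (m - h) h p))"

text \<open>A positive mode acts nontrivially only if its letter occurs in \<open>p\<close>, and
  both modes are negative, or both positive, only for \<open>h\<close> between 0 and
  \<open>m\<close>.\<close>

lemma finite_V:
  assumes p: "p \<in> Pol S"
  shows "finite {h. V r 0 i j (m - h) h p \<noteq> 0}"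
proof (rule finite_subset)
  let ?L = "letters p"
  show "finite ({m..0} \<union> {0..m} \<union> (\<lambda>a. - snd a) ` ?L \<union> (\<lambda>a. snd a + m) ` ?L)"
    by (simp add: finite_letters)
  show "{h. V r 0 i j (m - h) h p \<noteq> 0} \<subseteq> {m..0} \<union> {0..m} \<union> (\<lambda>a. - snd a) ` ?L \<union> (\<lambda>a. snd a + m) ` ?L"
  proof
    fix h assume "h \<in> {h. V r 0 i j (m - h) h p \<noteq> 0}"
    then have h: "V r 0 i j (m - h) h p \<noteq> 0" by simp
    show "h \<in> {m..0} \<union> {0..m} \<union> (\<lambda>a. - snd a) ` ?L \<union> (\<lambda>a. snd a + m) ` ?L"
    proof (cases rule: V_cases[of "m - h" h])
      case neg_pos
      with h have "E (i, m - h) (j, - h) p \<noteq> 0" by (auto simp: V_simps)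
      then have "(j, - h) \<in> ?L"
        using E_eq_0[OF Pol_letters[OF p]] by blast
      then show ?thesis by force
    next
      case pos_neg
      with h have "(i, - (m - h)) \<in> ?L"
        using E_eq_0[OF Pol_letters[OF p], of "(i, - (m - h))" "(j, h)"]
        by (auto simp: V_simps simp del: minus_diff_eq split: if_splits)
      then have "snd (i, - (m - h)) + m \<in> (\<lambda>a. snd a + m) ` ?L" by blast
      then show ?thesis by simp
    qed (use h in \<open>auto simp: V_simps\<close>)
  qed
qed

lemma finite_V_0:
  assumes p: "p \<in> Pol S"
  shows "finite {h. (if h > 0 then V r 0 i i (- h) h p else 0) \<noteq> 0}"
  by (rule finite_subset[OF _ finite_V[OF p, of r i i 0]]) auto

lemma lookup_Sum_any:
  assumes "finite {h. f h \<noteq> 0}"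
  shows "lookup (Sum_any f) \<mu> = Sum_any (\<lambda>h. lookup (f h) \<mu>)"
proof -
  have "Sum_any (\<lambda>h. lookup (f h) \<mu>) = (\<Sum>h\<in>{h. f h \<noteq> 0}. lookup (f h) \<mu>)"
    by (rule Sum_any.expand_superset[OF assms]) auto
  then show ?thesis by (simp add: Sum_any.expand_set lookup_sum)
qed

lemma Lop_eq_LL:
  assumes p: "p \<in> Pol S" and S: "S \<subseteq> negative"
  shows "Lop r i j m (lookup p) = lookup (LL r i j m p)"
proof (cases "i = j \<and> m = 0")
  case True
  then have [simp]: "j = i" "m = 0" by auto
  have "act_basis r (i, i, 0, 0) (lookup p) = 0"
    using act_basis_eq[OF p S, of "(i, i, 0, 0)" r] by (simp add: VS_UNIV Op_def V_simps fun_eq_iff)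
  then have z: "act_basis r (i, i, 0, 0) (lookup p) \<nu> = 0" for \<nu>
    by simp
  have 1: "(if h > 0 then act_basis r (i, i, - h, h) (lookup p) \<nu> else 0)
      = lookup (if h > 0 then V r 0 i i (- h) h p else 0) \<nu>" for h \<nu>
    using act_basis_eq[OF p S, of "(i, i, - h, h)" r] by (simp add: VS_UNIV Op_def)
  have LL: "LL r i j m p = Sum_any (\<lambda>h. if h > 0 then V r 0 i i (- h) h p else 0)"
    by (simp add: LL_def)
  show ?thesis
  proof
    fix \<nu>
    have "Lop r i j m (lookup p) \<nu> = Sum_any (\<lambda>h. if h > 0 then act_basis r (i, i, - h, h) (lookup p) \<nu> else 0)"
      by (simp add: Lop_def z)
    also have "\<dots> = lookup (LL r i j m p) \<nu>"
      unfolding 1 LL by (rule lookup_Sum_any[OF finite_V_0[OF p], symmetric])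
    finally show "Lop r i j m (lookup p) \<nu> = lookup (LL r i j m p) \<nu>" .
  qed
next
  case False
  have "V r 1 i j (m - h) h p = V r 0 i j (m - h) h p" for h
    using False by (intro V_scalar) auto
  then show ?thesis
    unfolding Lop_def LL_def if_not_P[OF False] act_vnorm_eq[OF p S]
    by (intro ext) (simp only: lookup_Sum_any[OF finite_V[OF p]] lookup_cst_times)
qed

lemma LL_add:
  assumes "p \<in> Pol S" "q \<in> Pol S"
  shows "LL r i j m (p + q) = LL r i j m p + LL r i j m q"
proof -
  have 1: "Sum_any (\<lambda>h. V r 0 i j (m - h) h p + V r 0 i j (m - h) h q)
      = Sum_any (\<lambda>h. V r 0 i j (m - h) h p) + Sum_any (\<lambda>h. V r 0 i j (m - h) h q)"
    by (rule Sum_any.distrib) (rule finite_V assms)+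
  have "Sum_any (\<lambda>h. (if h > 0 then V r 0 i i (- h) h p else 0) + (if h > 0 then V r 0 i i (- h) h q else 0))
      = Sum_any (\<lambda>h. if h > 0 then V r 0 i i (- h) h p else 0) + Sum_any (\<lambda>h. if h > 0 then V r 0 i i (- h) h q else 0)"
    by (rule Sum_any.distrib) (rule finite_V_0 assms)+
  moreover have "(if h > 0 then V r 0 i i (- h) h (p + q) else 0)
      = (if h > 0 then V r 0 i i (- h) h p else 0) + (if h > 0 then V r 0 i i (- h) h q else 0)" for h
    by (simp add: lin_add[OF lin_V])
  ultimately show ?thesis
    using 1 by (simp add: LL_def lin_add[OF lin_V] distrib_left)
qed

lemma LL_cst:
  assumes "p \<in> Pol S"
  shows "LL r i j m (cst c * p) = cst c * LL r i j m p"
proof (cases "i = j \<and> m = 0")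
  case True
  have 1: "(if h > 0 then V r 0 i i (- h) h (cst c * p) else 0)
      = cst c * (if h > 0 then V r 0 i i (- h) h p else 0)" for h
    by (simp add: lin_cst[OF lin_V])
  show ?thesis
    unfolding LL_def if_P[OF True] 1 by (rule Sum_any_right_distrib[OF finite_V_0[OF assms], symmetric])
next
  case False
  have 1: "Sum_any (\<lambda>h. V r 0 i j (m - h) h (cst c * p)) = cst c * Sum_any (\<lambda>h. V r 0 i j (m - h) h p)"
    unfolding lin_cst[OF lin_V] by (rule Sum_any_right_distrib[OF finite_V[OF assms], symmetric])
  show ?thesis
    unfolding LL_def if_not_P[OF False] 1 by (rule mult.left_commute)
qed

section \<open>Separating the modes\<close>

lemma psub_Sum_any: "psub W \<Longrightarrow> (\<And>h. f h \<in> W) \<Longrightarrow> Sum_any f \<in> W"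
  unfolding Sum_any.expand_set by (rule psub_sum)

lemma psub_if: "psub W \<Longrightarrow> (P \<Longrightarrow> p \<in> W) \<Longrightarrow> (if P then p else 0) \<in> W"
  by (simp add: psub_zero)

lemma LL_mem:
  assumes W: "psub W"
    and X: "\<And>a b p. a \<in> C \<times> {..<0} \<Longrightarrow> b \<in> C \<times> {..<0} \<Longrightarrow> p \<in> W \<Longrightarrow> X a b * p \<in> W"
    and E: "\<And>a b p. a \<in> C \<times> {..<0} \<Longrightarrow> b \<in> C \<times> {..<0} \<Longrightarrow> p \<in> W \<Longrightarrow> E a b p \<in> W"
    and D: "\<And>a b p. a \<in> C \<times> {..<0} \<Longrightarrow> b \<in> C \<times> {..<0} \<Longrightarrow> p \<in> W \<Longrightarrow> D r a b p \<in> W"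
    and ij: "i \<in> C" "j \<in> C" and p: "p \<in> W"
  shows "LL r i j m p \<in> W"
proof -
  have V: "V r 0 k l m n p \<in> W" if "k \<in> C" "l \<in> C" for k l m n
    using that p by (cases rule: V_cases[of m n])
      (auto simp: V_simps V_zero simp del: single_of_int single_zero intro!: X E D psub_add[OF W]
        psub_cst[OF W] psub_zero[OF W] psub_if[OF W])
  show ?thesis
    unfolding LL_def using ij by (auto intro!: psub_Sum_any psub_cst psub_if W V)
qed

text \<open>The share of colour \<open>j\<close> in the degree, which is the eigenvalue of
  L^{jj}(0).\<close>

definition colour_weight :: "nat \<Rightarrow> letter \<Rightarrow> int" where
  "colour_weight j a = (if fst a = j then - snd a else 0)"

lemma LL_diagonal:
  assumes p: "p \<in> Pol S" and S: "S \<subseteq> negative"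
  shows "lookup (LL r j j 0 p) \<mu> = of_int (wt (colour_weight j) \<mu>) * lookup p \<mu>"
proof -
  define H where "H = {h. h > 0 \<and> (j, - h) \<in> letters p}"
  have "H \<subseteq> (\<lambda>a. - snd a) ` letters p"
    by (force simp: H_def)
  then have finH: "finite H" by (rule finite_subset) (simp add: finite_letters)
  \<comment> \<open>A finite truncation adapted to \<open>p\<close>: letters not occurring in
    \<open>p\<close> contribute nothing, and on polynomials in the letters of \<open>p\<close> the
    operator \<open>T\<close> is diagonal.\<close>
  define T where "T q = (\<Sum>h\<in>H. cst (of_int h) * E (j, - h) (j, - h) q)" for q
  have mode: "V r 0 j j (- h) h p = cst (of_int h) * E (j, - h) (j, - h) p" if "h > 0" for h
    using that by (simp add: V_simps)
  have "LL r j j 0 p = Sum_any (\<lambda>h. if h > 0 then V r 0 j j (- h) h p else 0)"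
    by (simp add: LL_def)
  also have "\<dots> = (\<Sum>h\<in>H. if h > 0 then V r 0 j j (- h) h p else 0)"
  proof (rule Sum_any.expand_superset[OF finH], rule subsetI)
    fix h assume "h \<in> {h. (if h > 0 then V r 0 j j (- h) h p else 0) \<noteq> 0}"
    then have h: "h > 0" "V r 0 j j (- h) h p \<noteq> 0" by (auto split: if_splits)
    then have "E (j, - h) (j, - h) p \<noteq> 0" by (auto simp: mode)
    with h(1) show "h \<in> H" using E_eq_0[OF Pol_letters[OF p]] by (auto simp: H_def)
  qed
  also have "\<dots> = T p"
    unfolding T_def by (intro sum.cong) (auto simp: H_def mode)
  finally have LL: "LL r j j 0 p = T p" .
  have lin: "lin T"
  proof (rule linI)
    show "T (q + q') = T q + T q'" for q q'
      unfolding T_def E_lin distrib_left sum.distrib ..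
    show "T (cst c * q) = cst c * T q" for c q
      unfolding T_def E_lin sum_distrib_left by (simp only: mult.left_commute)
  qed
  have key: "(\<Sum>h\<in>H. cst (of_int h) * (kd a (j, - h) * (X (j, - h) b * q)))
      = cst (of_int (colour_weight j a)) * (X a b * q)" if a: "a \<in> letters p" for a b q
  proof (cases "fst a = j")
    case True
    then obtain h where h: "a = (j, - h)" by (metis minus_minus prod.collapse)
    have "snd a < 0" using letters_Pol[OF p] S a by (auto simp: negative_def)
    then have hH: "h \<in> H" using a by (simp add: H_def h)
    have "(\<Sum>h'\<in>H. cst (of_int h') * (kd a (j, - h') * (X (j, - h') b * q)))
        = (\<Sum>h'\<in>H. if h' = h then cst (of_int h') * (X (j, - h') b * q) else 0)"
      by (intro sum.cong) (auto simp: h kd_def simp del: single_of_int)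
    then show ?thesis
      using hH finH by (simp add: h colour_weight_def del: single_of_int)
  next
    case False
    then have "kd a (j, - h) = 0" for h by (auto intro!: kd_neq)
    with False show ?thesis by (simp add: colour_weight_def)
  qed
  have X: "T (X a b * q) = X a b * T q + cst (of_int (colour_weight j a + colour_weight j b)) * (X a b * q)"
    if ab: "a \<in> letters p" "b \<in> letters p" for a b q
  proof -
    have "T (X a b * q) = (\<Sum>h\<in>H. X a b * (cst (of_int h) * E (j, - h) (j, - h) q)
        + (cst (of_int h) * (kd a (j, - h) * (X (j, - h) b * q))
        + cst (of_int h) * (kd b (j, - h) * (X (j, - h) a * q))))"
      unfolding T_def E_X by (intro sum.cong refl) (simp add: algebra_simps del: single_of_int)
    also have "\<dots> = X a b * T q + (cst (of_int (colour_weight j a)) * (X a b * q)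
        + cst (of_int (colour_weight j b)) * (X a b * q))"
      unfolding sum.distrib key[OF ab(1)] key[OF ab(2)] T_def sum_distrib_left[symmetric]
        X_commute[of b a] ..
    finally show ?thesis
      by (simp only: distrib_right single_add of_int_add)
  qed
  show ?thesis
    unfolding LL by (rule diagonal_operator[OF lin _ X Pol_letters[OF p]]) (simp_all add: T_def)
qed

lemma V_hom:
  assumes "i \<noteq> j" and "p \<in> hom (colour_weight j) c"
  shows "V r s i j m n p \<in> hom (colour_weight j) (c - n)"
proof (cases rule: V_cases[of m n])
  case neg_neg
  with assms X_hom[OF assms(2), of "(i, m)" "(j, n)"] show ?thesis
    by (simp add: V_simps colour_weight_def)
next
  case neg_pos
  with assms E_hom[OF assms(2), of "(i, m)" "(j, - n)"] show ?thesis
    by (simp add: V_simps colour_weight_def psub_cst[OF psub_hom] del: single_of_int)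
next
  case pos_neg
  with assms E_hom[OF assms(2), of "(j, n)" "(i, - m)"] show ?thesis
    by (simp add: V_simps colour_weight_def psub_cst[OF psub_hom] del: single_of_int)
next
  case pos_pos
  with assms D_hom[OF assms(2), of r "(i, - m)" "(j, - n)"] show ?thesis
    by (simp add: V_simps colour_weight_def psub_cst[OF psub_hom] del: single_of_int)
qed (auto simp: V_zero psub_zero[OF psub_hom])

text \<open>L^{jj}(0) is diagonal, and v^{ij}(m,n) shifts its eigenvalue by -n when i and j differ.
  Hence the single modes can be recovered from their infinite sum.\<close>

lemma V_mem:
  assumes W: "psub W" "W \<subseteq> Pol S" and S: "S \<subseteq> negative"
    and LL: "\<And>p m. p \<in> W \<Longrightarrow> LL r i j m p \<in> W" "\<And>p. p \<in> W \<Longrightarrow> LL r j j 0 p \<in> W"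
    and ij: "i \<noteq> j" and p: "p \<in> W"
  shows "V r 0 i j m n p \<in> W"
proof -
  let ?w = "colour_weight j"
  have prjW: "prj ?w c q \<in> W" if "q \<in> W" for q c
    using LL(2) LL_diagonal[OF _ S] W that by (intro prj_mem[where T = "LL r j j 0"]) auto
  have hom: "V r 0 i j m n q \<in> W" if q: "q \<in> W" "q \<in> hom ?w c" for q c
  proof -
    have qS: "q \<in> Pol S" using q W by blast
    \<comment> \<open>The mode \<open>n\<close> is inserted so that the sum contains it even if its
      term vanishes. The term of mode \<open>h\<close> has weight \<open>c - h\<close>, so
      projecting to \<open>c - n\<close> isolates it.\<close>
    define H where "H = insert n {h. V r 0 i j (m + n - h) h q \<noteq> 0}"
    have finH: "finite H" unfolding H_def using finite_V[OF qS] by simp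
    have "LL r i j (m + n) q = cst (1 / 2) * Sum_any (\<lambda>h. V r 0 i j (m + n - h) h q)"
      using ij by (simp add: LL_def)
    also have "Sum_any (\<lambda>h. V r 0 i j (m + n - h) h q) = (\<Sum>h\<in>H. V r 0 i j (m + n - h) h q)"
      by (rule Sum_any.expand_superset[OF finH]) (simp add: H_def subset_insertI)
    finally have "prj ?w (c - n) (LL r i j (m + n) q)
        = cst (1 / 2) * prj ?w (c - n) (\<Sum>h\<in>H. V r 0 i j (m + n - h) h q)"
      by (simp only: lin_cst[OF lin_prj])
    also have "prj ?w (c - n) (\<Sum>h\<in>H. V r 0 i j (m + n - h) h q)
        = (\<Sum>h\<in>H. if h = n then V r 0 i j (m + n - h) h q else 0)"
      unfolding lin_sum[OF lin_prj] using prj_eq[OF V_hom[OF ij q(2)]] by (intro sum.cong) auto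
    also have "\<dots> = V r 0 i j m n q" using finH by (simp add: H_def)
    finally have "cst (1 / 2) * V r 0 i j m n q \<in> W"
      using prjW[OF LL(1)[OF q(1)], of "c - n" "m + n"] by simp
    then show ?thesis by (rule psub_cancel[OF W(1), rotated]) simp
  qed
  have "(\<Sum>c\<in>wt ?w ` keys p. V r 0 i j m n (prj ?w c p)) \<in> W"
    by (rule psub_sum[OF W(1) hom[OF prjW[OF p] prj_hom]])
  then show ?thesis by (simp flip: lin_sum[OF lin_V] sum_prj)
qed

context
  fixes W :: "pol set" and C :: "nat set" and r :: complex
  assumes W: "psub W" "W \<subseteq> Pol (C \<times> {..<0})"
    and LL: "\<And>i j m p. i \<in> C \<Longrightarrow> j \<in> C \<Longrightarrow> p \<in> W \<Longrightarrow> LL r i j m p \<in> W"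
begin

lemma V_mem_distinct:
  "i \<in> C \<Longrightarrow> j \<in> C \<Longrightarrow> i \<noteq> j \<Longrightarrow> p \<in> W \<Longrightarrow> V r 0 i j m n p \<in> W"
  by (rule V_mem[OF W]) (auto simp: negative_def LL)

lemma XED_mem_distinct:
  assumes a: "a \<in> C \<times> {..<0}" and b: "b \<in> C \<times> {..<0}" and ab: "fst a \<noteq> fst b" and p: "p \<in> W"
  shows "X a b * p \<in> W" "E a b p \<in> W" "D r a b p \<in> W"
proof -
  obtain i m j n where ij: "a = (i, m)" "b = (j, n)" by (cases a; cases b)
  with a b have neg: "m < 0" "n < 0" "- m > 0" "- n > 0" "i \<in> C" "j \<in> C" by auto
  note V = V_mem_distinct[OF neg(5,6) _ p]
  show "X a b * p \<in> W"
    using V[of m n] ab neg by (simp add: ij V_simps)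
  have "cst (of_int (- n)) * E a b p \<in> W"
    using V[of m "- n"] ab neg by (simp add: ij V_simps del: single_of_int)
  then show "E a b p \<in> W" by (rule psub_cancel[OF W(1), rotated]) (use neg in simp)
  have "cst (of_int (- m) * of_int (- n)) * D r a b p \<in> W"
    using V[of "- m" "- n"] ab neg by (simp add: ij V_simps del: single_of_int)
  then show "D r a b p \<in> W" by (rule psub_cancel[OF W(1), rotated]) (use neg in simp)
qed

text \<open>Modes of a single colour are commutators of modes that pass through a letter P of
  another colour not occurring in the vector.\<close>

lemma XED_mem:
  assumes C: "\<And>i. \<exists>j\<in>C. j \<noteq> i"
    and a: "a \<in> C \<times> {..<0}" and b: "b \<in> C \<times> {..<0}" and p: "p \<in> W"
  shows "X a b * p \<in> W" "E a b p \<in> W" "D r a b p \<in> W"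
proof -
  have "X a b * p \<in> W \<and> E a b p \<in> W \<and> D r a b p \<in> W"
  proof (cases "fst a = fst b")
    case False
    then show ?thesis using XED_mem_distinct[OF a b _ p] by blast
  next
    case True
    obtain j where j: "j \<in> C" "j \<noteq> fst a" using C by blast
    have pC: "p \<in> Pol (C \<times> {..<0})" using p W by blast
    have "infinite ((\<lambda>k. (j, - int k - 1)) ` UNIV)"
      by (subst finite_image_iff) (auto simp: inj_on_def)
    then obtain k where k: "(j, - int k - 1) \<notin> letters p"
      using finite_letters finite_subset by (metis image_subsetI)
    define P where "P = (j, - int k - 1)"
    have P: "P \<in> C \<times> {..<0}" "fst a \<noteq> fst P" "fst P \<noteq> fst b"
      using j True by (auto simp: P_def)
    have fresh: "E q P p = 0" "D r q P p = 0" for q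
      using k E_eq_0[OF Pol_letters[OF pC]] D_eq_0[OF Pol_letters[OF pC]] by (auto simp: P_def)
    have kd: "kd b P = 0" "kd a P = 0" using P by (auto intro!: kd_neq)
    \<comment> \<open>In each of the next three products the operator on the right brings in
      \<open>P\<close>, the one on the left removes it. Since \<open>P\<close> is new to
      \<open>p\<close>, only the commutator survives.\<close>
    have "E a P (X P b * p) = X a b * p"
      by (simp add: E_X fresh kd)
    moreover have "E a P (E P b p) = E a b p"
      unfolding E_E[of a P] by (simp add: fresh E_lin)
    moreover have "D r a P (E P b p) = D r a b p"
      unfolding D_E by (simp add: fresh E_lin kd)
    ultimately show ?thesis
      using XED_mem_distinct[OF P(1) b P(3) p] XED_mem_distinct[OF a P(1) P(2)] by metis
  qed
  then show "X a b * p \<in> W" "E a b p \<in> W" "D r a b p \<in> W" by auto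
qed

end

section \<open>Ideals of \<open>V\<^sub>J\<close>\<close>

lemma lookup_plus: "lookup (p + q) = lookup p + lookup q"
  by (simp add: fun_eq_iff lookup_add)

lemma lookup_zero_fun: "lookup 0 = 0"
  by (simp add: fun_eq_iff)

lemma lookup_smult: "lookup (cst c * p) = smult c (lookup p)"
  by (simp add: fun_eq_iff smult_def)

lemma lookup_one_eq: "lookup 1 = vac"
  by (auto simp: vac_def mono_def lookup_one fun_eq_iff when_def)

definition J_letters :: "nat \<Rightarrow> letter set" where
  "J_letters d = {1..d} \<times> {..<0}"

lemma J_letters_negative: "J_letters d \<subseteq> negative"
  by (auto simp: J_letters_def negative_def)

lemma LL_Pol:
  assumes "i \<in> {1..d}" "j \<in> {1..d}" "p \<in> Pol (J_letters d)"
  shows "LL r i j m p \<in> Pol (J_letters d)"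
  by (rule LL_mem[OF psub_Pol _ _ _ assms(1,2,3)]) (simp_all only: X_Pol E_Pol D_Pol J_letters_def)

lemma VJ_subset: "VJ d r \<subseteq> lookup ` Pol (J_letters d)"
proof
  fix v assume "v \<in> VJ d r"
  then show "v \<in> lookup ` Pol (J_letters d)"
    unfolding VJ_def
  proof (induction rule: lspan.induct)
    case lspan_zero
    show ?case using imageI[OF psub_zero[OF psub_Pol], of lookup] by (simp only: lookup_zero_fun)
  next
    case (lspan_gen g)
    then obtain ops where g: "g = foldr (\<lambda>(i, j, m) w. Lop r i j m w) ops vac"
      and ops: "\<forall>(i, j, m)\<in>set ops. i \<in> {1..d} \<and> j \<in> {1..d}" by blast
    from ops show ?case unfolding g
    proof (induction ops)
      case Nil
      show ?case using imageI[OF one_Pol, of lookup] by (simp add: lookup_one_eq)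
    next
      case (Cons op ops)
      obtain i j m where op: "op = (i, j, m)" by (cases op)
      from Cons obtain p where p: "p \<in> Pol (J_letters d)"
        "foldr (\<lambda>(i, j, m) w. Lop r i j m w) ops vac = lookup p" by auto
      have "i \<in> {1..d}" "j \<in> {1..d}" using Cons.prems by (auto simp: op)
      then have "LL r i j m p \<in> Pol (J_letters d)" using p by (intro LL_Pol)
      then show ?case
        by (simp add: op p(2) Lop_eq_LL[OF p(1) J_letters_negative])
    qed
  next
    case (lspan_add u w)
    from lspan_add.IH show ?case
      by (elim imageE) (simp only: lookup_plus[symmetric] imageI psub_add[OF psub_Pol])
  next
    case (lspan_smult u a)
    from lspan_smult.IH show ?case
      by (elim imageE) (simp only: lookup_smult[symmetric] imageI psub_cst[OF psub_Pol])
  qed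
qed

lemma VJ_closed:
  shows "0 \<in> VJ d r" "u \<in> VJ d r \<Longrightarrow> w \<in> VJ d r \<Longrightarrow> u + w \<in> VJ d r" "u \<in> VJ d r \<Longrightarrow> smult a u \<in> VJ d r"
  unfolding VJ_def by (rule lspan.intros; assumption)+

lemma vac_VJ: "vac \<in> VJ d r"
  unfolding VJ_def by (rule lspan_gen) (auto intro!: exI[of _ "[]"])

lemma Lop_VJ:
  assumes ij: "i \<in> {1..d}" "j \<in> {1..d}" and v: "v \<in> VJ d r"
  shows "Lop r i j m v \<in> VJ d r"
  using v unfolding VJ_def
proof (induction rule: lspan.induct)
  case lspan_zero
  have "Lop r i j m (lookup 0) = lookup (LL r i j m 0)"
    by (rule Lop_eq_LL[OF psub_zero[OF psub_Pol] J_letters_negative])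
  moreover have "LL r i j m 0 = 0" by (simp add: LL_def lin_zero[OF lin_V] cong: if_cong)
  ultimately have "Lop r i j m 0 = 0" by (simp add: lookup_zero_fun)
  then show ?case by (simp only: lspan.lspan_zero)
next
  case (lspan_gen g)
  then obtain ops where "g = foldr (\<lambda>(i, j, m) w. Lop r i j m w) ops vac"
    and "\<forall>(i, j, m)\<in>set ops. i \<in> {1..d} \<and> j \<in> {1..d}" by blast
  then have "Lop r i j m g = foldr (\<lambda>(i, j, m) w. Lop r i j m w) ((i, j, m) # ops) vac"
    "\<forall>(i, j, m)\<in>set ((i, j, m) # ops). i \<in> {1..d} \<and> j \<in> {1..d}" using ij by simp_all
  then show ?case by (intro lspan.lspan_gen) blast
next
  case (lspan_add u w)
  then obtain p q where pq: "u = lookup p" "w = lookup q" "p \<in> Pol (J_letters d)" "q \<in> Pol (J_letters d)"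
    using VJ_subset[of d r] unfolding VJ_def by blast
  have "Lop r i j m (u + w) = Lop r i j m u + Lop r i j m w"
    using pq by (simp add: Lop_eq_LL[OF _ J_letters_negative[of d]] LL_add psub_add[OF psub_Pol] flip: lookup_plus)
  with lspan_add.IH show ?case by (simp only: lspan.lspan_add)
next
  case (lspan_smult u a)
  then obtain p where p: "u = lookup p" "p \<in> Pol (J_letters d)"
    using VJ_subset[of d r] unfolding VJ_def by blast
  have "Lop r i j m (smult a u) = smult a (Lop r i j m u)"
    using p by (simp add: Lop_eq_LL[OF _ J_letters_negative[of d]] LL_cst psub_cst[OF psub_Pol] flip: lookup_smult)
  with lspan_smult.IH show ?case by (simp only: lspan.lspan_smult)
qed

lemma image_subspace:
  assumes W: "psub W"
  shows "subspace (lookup ` W)"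
  unfolding subspace_def
proof (intro conjI ballI allI)
  show "0 \<in> lookup ` W"
    using imageI[OF psub_zero[OF W], of lookup] by (simp only: lookup_zero_fun)
  show "u + w \<in> lookup ` W" if "u \<in> lookup ` W" "w \<in> lookup ` W" for u w
    using that by (elim imageE) (simp only: lookup_plus[symmetric] imageI psub_add[OF W])
  show "smult a u \<in> lookup ` W" if "u \<in> lookup ` W" for a u
    using that by (elim imageE) (simp only: lookup_smult[symmetric] imageI psub_cst[OF W])
qed

lemma preimage_psub: "subspace I \<Longrightarrow> psub {p \<in> Pol S. lookup p \<in> I}"
  using psub_Pol[of S]
  by (auto simp: psub_def subspace_def lookup_plus lookup_smult lookup_zero_fun)

text \<open>Transfers the separation of modes from polynomials to coefficient functions; it is
  applied both to \<open>VJ d r\<close> itself and to its ideals.\<close>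

lemma preimage_XD:
  assumes d: "d \<ge> 2" and I: "subspace I"
    and Lop: "\<And>i j m v. i \<in> {1..d} \<Longrightarrow> j \<in> {1..d} \<Longrightarrow> v \<in> I \<Longrightarrow> Lop r i j m v \<in> I"
    and a: "a \<in> J_letters d" and b: "b \<in> J_letters d" and p: "p \<in> Pol (J_letters d)" "lookup p \<in> I"
  shows "lookup (X a b * p) \<in> I" "lookup (D r a b p) \<in> I"
proof -
  let ?W = "{p \<in> Pol (J_letters d). lookup p \<in> I}"
  have LL: "LL r i j m q \<in> ?W" if "i \<in> {1..d}" "j \<in> {1..d}" "q \<in> ?W" for i j m q
  proof -
    have q: "q \<in> Pol (J_letters d)" "lookup q \<in> I" using that by auto
    show ?thesis
      using LL_Pol[OF that(1,2) q(1)] Lop[OF that(1,2) q(2)]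
      by (simp add: Lop_eq_LL[OF q(1) J_letters_negative])
  qed
  have C: "\<exists>j\<in>{1..d}. j \<noteq> i" for i
    using d by (intro bexI[of _ "if i = 1 then 2 else 1"]) auto
  have W: "?W \<subseteq> Pol ({1..d} \<times> {..<0})" by (auto simp: J_letters_def)
  have pW: "p \<in> ?W" using p by simp
  note mem = XED_mem[OF preimage_psub[OF I] W LL C a[unfolded J_letters_def] b[unfolded J_letters_def] pW]
  show "lookup (X a b * p) \<in> I" "lookup (D r a b p) \<in> I" using mem(1,3) by blast+
qed

lemma VJ_eq:
  assumes d: "d \<ge> 2"
  shows "VJ d r = lookup ` Pol (J_letters d)"
proof
  have sub: "subspace (VJ d r)"
    by (simp add: subspace_def VJ_closed)
  have "lookup p \<in> VJ d r" if "p \<in> Pol (J_letters d)" for p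
    using that
  proof (induction p rule: Pol_induct)
    case one
    show ?case by (simp add: lookup_one_eq vac_VJ)
  next
    case (X a b p)
    then show ?case using preimage_XD(1)[OF d sub Lop_VJ] by blast
  next
    case (add p q)
    show ?case unfolding lookup_plus using add(3,4) by (rule VJ_closed)
  next
    case (cst c p)
    show ?case unfolding lookup_smult using cst(2) by (rule VJ_closed)
  qed
  then show "lookup ` Pol (J_letters d) \<subseteq> VJ d r" by blast
qed (rule VJ_subset)

lemma Sum_any_subspace:
  fixes f :: "'b \<Rightarrow> vec"
  assumes "subspace I" "\<And>h. f h \<in> I"
  shows "Sum_any f \<in> I"
proof -
  have "(\<Sum>h\<in>A. f h) \<in> I" for A
    using assms by (induction A rule: infinite_finite_induct) (auto simp: subspace_def)
  then show ?thesis by (simp add: Sum_any.expand_set)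
qed

lemma smult_simps [simp]: "smult 1 v = v" "smult 0 v = 0" "smult a 0 = 0"
  by (simp_all add: smult_def fun_eq_iff)

lemma Sum_any_only_0:
  fixes f :: "nat \<Rightarrow> vec"
  assumes "\<And>i. i > 0 \<Longrightarrow> f i = 0"
  shows "Sum_any f = f 0"
proof -
  have "Sum_any f = (\<Sum>i\<in>{0}. f i)"
    using assms by (intro Sum_any.expand_superset) (auto intro: gr0I)
  then show ?thesis by simp
qed

lemma gbinomial_zero: "(0 :: complex) gchoose i = (if i = 0 then 1 else 0)"
  by (cases i) (simp_all add: gbinomial_0)

locale VJ_operator =
  fixes d :: nat and r :: complex and Y :: "vec \<Rightarrow> int \<Rightarrow> vec \<Rightarrow> vec"
  assumes d: "d \<ge> 2" and VJY: "VJ_vertex_operator d r Y"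
begin

lemma VOA: "is_VOA (VJ d r) Y vac (omega d r) (of_nat d * r)"
  and Y_omega: "i \<in> {1..d} \<Longrightarrow> j \<in> {1..d} \<Longrightarrow> w \<in> VJ d r \<Longrightarrow> Y (omega_ij r i j) n w = Lop r i j (n - 1) w"
  using VJY by (auto simp: VJ_vertex_operator_def)

lemma Y_linear_left: "u \<in> VJ d r \<Longrightarrow> u' \<in> VJ d r \<Longrightarrow> w \<in> VJ d r \<Longrightarrow>
    Y (smult a u + smult b u') n w = smult a (Y u n w) + smult b (Y u' n w)"
  and Y_linear_right: "u \<in> VJ d r \<Longrightarrow> w \<in> VJ d r \<Longrightarrow> w' \<in> VJ d r \<Longrightarrow>
    Y u n (smult a w + smult b w') = smult a (Y u n w) + smult b (Y u n w')"
  and Y_vac: "w \<in> VJ d r \<Longrightarrow> Y vac n w = (if n = -1 then w else 0)"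
  and Y_creation: "u \<in> VJ d r \<Longrightarrow> Y u (-1) vac = u" "u \<in> VJ d r \<Longrightarrow> n \<ge> 0 \<Longrightarrow> Y u n vac = 0"
  and Borcherds: "u \<in> VJ d r \<Longrightarrow> v \<in> VJ d r \<Longrightarrow> w \<in> VJ d r \<Longrightarrow>
        Sum_any (\<lambda>i::nat. smult (of_int p gchoose i) (Y (Y u (s + int i) v) (p + q - int i) w))
      = Sum_any (\<lambda>i::nat. smult ((-1) ^ i * (of_int s gchoose i))
           (Y u (p + s - int i) (Y v (q + int i) w)
            - smult ((-1) powi s) (Y v (q + s - int i) (Y u (p + int i) w))))"
  and omega_VJ: "omega d r \<in> VJ d r"
  and Y_derivative: "u \<in> VJ d r \<Longrightarrow> w \<in> VJ d r \<Longrightarrow>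
    Y (Y (omega d r) 0 u) n w = smult (- of_int n) (Y u (n - 1) w)"
  using VOA unfolding is_VOA_def by simp_all

lemma omega_ij_VJ: "i \<in> {1..d} \<Longrightarrow> j \<in> {1..d} \<Longrightarrow> omega_ij r i j \<in> VJ d r"
  unfolding omega_ij_def by (rule Lop_VJ[OF _ _ vac_VJ])

lemma Y_zero_left: "w \<in> VJ d r \<Longrightarrow> Y 0 n w = 0"
  using Y_linear_left[OF vac_VJ vac_VJ, of w 0 0 n] by simp

lemma VJ_induct [consumes 1, case_names zero vac Lop add smult]:
  assumes "v \<in> VJ d r" and zero: "P 0" and vac: "P vac"
    and Lop: "\<And>i j m v. i \<in> {1..d} \<Longrightarrow> j \<in> {1..d} \<Longrightarrow> v \<in> VJ d r \<Longrightarrow> P v \<Longrightarrow> P (Lop r i j m v)"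
    and add: "\<And>u v. u \<in> VJ d r \<Longrightarrow> v \<in> VJ d r \<Longrightarrow> P u \<Longrightarrow> P v \<Longrightarrow> P (u + v)"
    and smult: "\<And>a v. v \<in> VJ d r \<Longrightarrow> P v \<Longrightarrow> P (smult a v)"
  shows "P v"
  using assms(1) unfolding VJ_def
proof (induction rule: lspan.induct)
  case (lspan_gen g)
  then obtain ops where g: "g = foldr (\<lambda>(i, j, m) w. Lop r i j m w) ops vac"
    and ops: "\<forall>(i, j, m)\<in>set ops. i \<in> {1..d} \<and> j \<in> {1..d}" by blast
  have "g \<in> VJ d r \<and> P g"
    using ops unfolding g by (induction ops) (auto intro: vac_VJ vac Lop Lop_VJ)
  then show ?case ..
next
  case (lspan_add u w)
  then show ?case by (intro add[unfolded VJ_def])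
next
  case (lspan_smult u a)
  then show ?case by (intro smult[unfolded VJ_def])
qed (rule zero)

section \<open>Subspaces stable under all L^{ij}(m) are ideals\<close>

context
  fixes I :: "vec set"
  assumes I: "subspace I" "I \<subseteq> VJ d r"
    and Lop_I: "\<And>i j m v. i \<in> {1..d} \<Longrightarrow> j \<in> {1..d} \<Longrightarrow> v \<in> I \<Longrightarrow> Lop r i j m v \<in> I"
begin

lemma I_VJ: "w \<in> I \<Longrightarrow> w \<in> VJ d r"
  and I_add: "u \<in> I \<Longrightarrow> w \<in> I \<Longrightarrow> u + w \<in> I"
  and I_smult: "u \<in> I \<Longrightarrow> smult a u \<in> I"
  and I_zero: "0 \<in> I"
  using I by (auto simp: subspace_def)

lemma I_diff: "u \<in> I \<Longrightarrow> w \<in> I \<Longrightarrow> u - w \<in> I"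
proof -
  assume "u \<in> I" "w \<in> I"
  then have "u + smult (-1) w \<in> I" by (intro I_add I_smult)
  moreover have "u + smult (-1) w = u - w" by (simp add: smult_def fun_eq_iff)
  ultimately show "u - w \<in> I" by simp
qed

text \<open>Borcherds' identity with p = 0 expresses the modes of (omega_ij)_k v by those of
  omega_ij and v.\<close>

lemma Y_I_right: "u \<in> VJ d r \<Longrightarrow> \<forall>n. \<forall>w\<in>I. Y u n w \<in> I"
proof (induction u rule: VJ_induct)
  case zero
  show ?case
  proof (intro allI ballI)
    fix n w assume "w \<in> I"
    then show "Y 0 n w \<in> I" by (simp only: Y_zero_left[OF I_VJ] I_zero)
  qed
next
  case vac
  then show ?case by (simp add: Y_vac I_VJ I_zero)
next
  case (Lop i j m v)
  let ?o = "omega_ij r i j"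
  have o: "?o \<in> VJ d r" using Lop by (intro omega_ij_VJ)
  have oI: "Y ?o n w \<in> I" if "w \<in> I" for n w
    using that Lop.hyps Lop_I Y_omega[of i j w n] by (simp add: I_VJ)
  show ?case
  proof (intro allI ballI)
    fix n w assume w: "w \<in> I"
    \<comment> \<open>The shift by one comes from the exponents: L(m) belongs to z^(-m-2), the mode
      of index n to z^(-n-1).\<close>
    have "Y (Lop r i j m v) n w = Y (Y ?o (m + 1) v) n w"
      using Y_omega[of i j v "m + 1"] Lop by simp
    also have "\<dots> = Sum_any (\<lambda>k::nat. smult (of_int 0 gchoose k) (Y (Y ?o (m + 1 + int k) v) (0 + n - int k) w))"
      by (subst Sum_any_only_0) (simp_all add: gbinomial_zero)
    also have "\<dots> = Sum_any (\<lambda>k::nat. smult ((-1) ^ k * (of_int (m + 1) gchoose k))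
           (Y ?o (0 + (m + 1) - int k) (Y v (n + int k) w)
            - smult ((-1) powi (m + 1)) (Y v (n + (m + 1) - int k) (Y ?o (0 + int k) w))))"
      by (rule Borcherds[OF o Lop.hyps(3) I_VJ[OF w]])
    also have "\<dots> \<in> I"
      using Lop.IH w oI by (intro Sum_any_subspace[OF I(1)] I_smult I_diff) blast+
    finally show "Y (Lop r i j m v) n w \<in> I" .
  qed
next
  case (add u v)
  show ?case
  proof (intro allI ballI)
    fix n w assume w: "w \<in> I"
    then have "Y (u + v) n w = Y u n w + Y v n w"
      using Y_linear_left[OF add.hyps, of w 1 1 n] by (simp add: I_VJ)
    then show "Y (u + v) n w \<in> I" using add.IH w by (simp add: I_add)
  qed
next
  case (smult a v)
  show ?case
  proof (intro allI ballI)
    fix n w assume w: "w \<in> I"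
    then have "Y (smult a v) n w = smult a (Y v n w)"
      using Y_linear_left[OF smult.hyps smult.hyps, of w a 0 n] by (simp add: I_VJ)
    then show "Y (smult a v) n w \<in> I" using smult.IH w by (simp add: I_smult)
  qed
qed

text \<open>The mode of index -1 returns \<open>w\<close>. Lower modes are reached by translation
  covariance: replacing \<open>w\<close> by \<open>Y (omega d r) 0 w\<close>, again in
  \<open>I\<close>, lowers the index by one up to the nonzero factor k + 1.\<close>

lemma Y_I_vac: "w \<in> I \<Longrightarrow> Y w n vac \<in> I"
proof -
  have "Y w (- int k - 1) vac \<in> I" if "w \<in> I" for k
    using that
  proof (induction k arbitrary: w)
    case 0
    then show ?case by (simp add: Y_creation I_VJ)
  next
    case (Suc k)
    have "Y (omega d r) 0 w \<in> I" using Y_I_right[OF omega_VJ] Suc.prems by blast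
    then have "Y (Y (omega d r) 0 w) (- int k - 1) vac \<in> I" by (rule Suc.IH)
    moreover have "Y (Y (omega d r) 0 w) (- int k - 1) vac
        = smult (of_nat (Suc k)) (Y w (- int (Suc k) - 1) vac)"
      unfolding Y_derivative[OF I_VJ[OF Suc.prems] vac_VJ] by (simp add: algebra_simps)
    ultimately have "smult (1 / of_nat (Suc k)) (smult (of_nat (Suc k)) (Y w (- int (Suc k) - 1) vac)) \<in> I"
      by (simp only: I_smult)
    moreover have "smult (1 / of_nat (Suc k)) (smult (of_nat (Suc k)) v) = v" for v
      by (simp add: smult_def del: of_nat_Suc)
    ultimately show ?case by simp
  qed
  note neg = this
  assume w: "w \<in> I"
  show ?thesis
  proof (cases "n \<ge> 0")
    case True
    then show ?thesis using w by (simp add: Y_creation I_VJ I_zero)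
  next
    case False
    then have "n = - int (nat (- n - 1)) - 1" by simp
    then show ?thesis using neg[OF w, of "nat (- n - 1)"] by simp
  qed
qed

text \<open>Borcherds' identity with s = 0 is the commutator formula.\<close>

lemma Y_I_left: "u \<in> VJ d r \<Longrightarrow> \<forall>n. \<forall>w\<in>I. Y w n u \<in> I"
proof (induction u rule: VJ_induct)
  case zero
  show ?case
  proof (intro allI ballI)
    fix n w assume "w \<in> I"
    then have "Y w n 0 = 0"
      using Y_linear_right[OF _ vac_VJ vac_VJ, of w n 0 0] by (simp add: I_VJ)
    then show "Y w n 0 \<in> I" by (simp add: I_zero)
  qed
next
  case vac
  then show ?case by (simp add: Y_I_vac)
next
  case (Lop i j m v)
  let ?o = "omega_ij r i j"
  have o: "?o \<in> VJ d r" using Lop by (intro omega_ij_VJ)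
  have oI: "Y ?o n w \<in> I" if "w \<in> I" for n w
    using Y_I_right[OF o] that by blast
  show ?case
  proof (intro allI ballI)
    fix n w assume w: "w \<in> I"
    \<comment> \<open>On the left, modes of vectors of \<open>I\<close> act on \<open>v\<close>,
      which the induction hypothesis covers. On the right only k = 0 survives and leaves the
      commutator, so the wanted term is a difference of members of \<open>I\<close>.\<close>
    have "Sum_any (\<lambda>k::nat. smult (of_int (m + 1) gchoose k) (Y (Y ?o (0 + int k) w) (m + 1 + n - int k) v))
      = Sum_any (\<lambda>k::nat. smult ((-1) ^ k * (of_int 0 gchoose k))
           (Y ?o (m + 1 + 0 - int k) (Y w (n + int k) v)
            - smult ((-1) powi 0) (Y w (n + 0 - int k) (Y ?o (m + 1 + int k) v))))"
      by (rule Borcherds[OF o I_VJ[OF w] Lop.hyps(3)])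
    also have "\<dots> = Y ?o (m + 1) (Y w n v) - Y w n (Y ?o (m + 1) v)"
      by (subst Sum_any_only_0) (simp_all add: gbinomial_zero)
    finally have "Y w n (Y ?o (m + 1) v) = Y ?o (m + 1) (Y w n v)
      - Sum_any (\<lambda>k::nat. smult (of_int (m + 1) gchoose k) (Y (Y ?o (0 + int k) w) (m + 1 + n - int k) v))"
      by (simp only: diff_diff_eq2 add_diff_cancel_left')
    also have "\<dots> \<in> I"
      using Lop.IH w oI by (intro I_diff Sum_any_subspace[OF I(1)] I_smult) blast+
    finally show "Y w n (Lop r i j m v) \<in> I"
      using Y_omega[of i j v "m + 1"] Lop by simp
  qed
next
  case (add u v)
  show ?case
  proof (intro allI ballI)
    fix n w assume w: "w \<in> I"
    then have "Y w n (u + v) = Y w n u + Y w n v"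
      using Y_linear_right[OF _ add.hyps, of w n 1 1] by (simp add: I_VJ)
    then show "Y w n (u + v) \<in> I" using add.IH w by (simp add: I_add)
  qed
next
  case (smult a v)
  show ?case
  proof (intro allI ballI)
    fix n w assume w: "w \<in> I"
    then have "Y w n (smult a v) = smult a (Y w n v)"
      using Y_linear_right[OF _ smult.hyps smult.hyps, of w n a 0] by (simp add: I_VJ)
    then show "Y w n (smult a v) \<in> I" using smult.IH w by (simp add: I_smult)
  qed
qed

lemma is_ideal_I: "is_ideal (VJ d r) Y I"
  using I Y_I_right Y_I_left by (simp add: is_ideal_def)

end

lemma ideal_Lop:
  assumes "is_ideal (VJ d r) Y I" "i \<in> {1..d}" "j \<in> {1..d}" "v \<in> I"
  shows "Lop r i j m v \<in> I"
proof -
  have "v \<in> VJ d r" "Y (omega_ij r i j) (m + 1) v \<in> I"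
    using assms omega_ij_VJ[of i j] by (auto simp: is_ideal_def)
  with assms show ?thesis using Y_omega[of i j v "m + 1"] by simp
qed

lemma simple_if_not_Ints:
  assumes r: "r \<notin> \<int>"
  shows "simple_VOA (VJ d r) Y"
  unfolding simple_VOA_def
proof (intro allI impI)
  fix I assume I: "is_ideal (VJ d r) Y I"
  then have sub: "subspace I" "I \<subseteq> VJ d r" by (auto simp: is_ideal_def)
  let ?W = "{p \<in> Pol (J_letters d). lookup p \<in> I}"
  have IW: "I = lookup ` ?W"
    using sub VJ_subset by blast
  show "I = {0} \<or> I = VJ d r"
  proof (cases "?W = {0}")
    case True
    have "I = lookup ` {0}" by (rule trans[OF IW arg_cong[where f = "image lookup", OF True]])
    then show ?thesis by (simp add: lookup_zero_fun)
  next
    case False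
    have W: "?W = Pol (J_letters d)"
    proof (rule Pol_irreducible[OF r preimage_psub[OF sub(1)] _ False])
      fix a b p assume "a \<in> J_letters d" "b \<in> J_letters d" "p \<in> ?W"
      then show "X a b * p \<in> ?W" "D r a b p \<in> ?W"
        using preimage_XD[OF d sub(1) ideal_Lop[OF I]] by (simp_all add: X_Pol D_Pol)
    qed blast
    have "I = VJ d r"
      unfolding VJ_eq[OF d] by (rule trans[OF IW arg_cong[where f = "image lookup", OF W]])
    then show ?thesis ..
  qed
qed

lemma not_simple_if_Ints:
  assumes r: "r \<in> \<int>"
  shows "\<not> simple_VOA (VJ d r) Y"
proof
  assume simple: "simple_VOA (VJ d r) Y"
  let ?S = "J_letters d" and ?I = "lookup ` Rad r (J_letters d)"
  have Rad_Pol: "Rad r ?S \<subseteq> Pol ?S" by (auto simp: Rad_def)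
  have inj: "lookup p = lookup q \<longleftrightarrow> p = q" for p q :: pol
    by (rule poly_mapping_eq_iff[symmetric])
  have mem: "lookup p \<in> ?I \<longleftrightarrow> p \<in> Rad r ?S" for p
    by (simp add: image_iff inj)
  have "is_ideal (VJ d r) Y ?I"
  proof (rule is_ideal_I)
    show "subspace ?I" by (rule image_subspace[OF psub_Rad])
    show "?I \<subseteq> VJ d r" unfolding VJ_eq[OF d] using Rad_Pol by blast
    fix i j m v assume ij: "i \<in> {1..d}" "j \<in> {1..d}" and "v \<in> ?I"
    then obtain p where p: "p \<in> Rad r ?S" "v = lookup p" by blast
    have "LL r i j m p \<in> Rad r ?S"
      by (rule LL_mem[OF psub_Rad _ _ _ ij p(1)]) (simp_all only: X_Rad E_Rad D_Rad J_letters_def)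
    then show "Lop r i j m v \<in> ?I"
      using Lop_eq_LL[OF _ J_letters_negative] p Rad_Pol by (auto simp: mem)
  qed
  with simple have I: "?I = {0} \<or> ?I = VJ d r" by (simp add: simple_VOA_def)
  obtain s where s: "s \<in> Pol ?S" "s \<noteq> 0" "lookup s {#} = 0" "\<And>a b. D r a b s = 0"
  proof (rule singular_vector_exists[OF r])
    \<comment> \<open>Infinitely many letters of one colour are available, enough for determinants
      of any size.\<close>
    show "inj (\<lambda>n. (1 :: nat, - int n - 1))" by (auto simp: inj_def)
    show "range (\<lambda>n. (1 :: nat, - int n - 1)) \<subseteq> ?S" using d by (auto simp: J_letters_def)
  qed blast
  have "lookup s \<in> ?I" using singular_Rad[OF s(1,3,4)] by (simp add: mem)
  moreover have "lookup s \<noteq> 0" using inj[of s 0] s(2) by (simp add: lookup_zero_fun)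
  ultimately have "?I = VJ d r" using I by blast
  then have "lookup 1 \<in> ?I" by (simp only: lookup_one_eq vac_VJ)
  then show False using one_notin_Rad by (simp only: mem)
qed

end

theorem theorem2p6:
  fixes d :: nat and r :: complex and Y :: "vec \<Rightarrow> int \<Rightarrow> vec \<Rightarrow> vec"
  assumes "d \<ge> 2"
    and "VJ_vertex_operator d r Y"
  shows "simple_VOA (VJ d r) Y \<longleftrightarrow> r \<notin> \<int>"
proof -
  interpret VJ_operator d r Y using assms by unfold_locales
  show ?thesis using simple_if_not_Ints not_simple_if_Ints by blast
qed

end
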